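(* Let $q\in(-1,1)$, $n\ge 1$, $x_1,\dots,x_n\in H$ and $\epsilon=(\epsilon(1),\dots,\epsilon(n))\in\{1,\ast\}^n$. Then, with $d_q^{1}(x):=d_q(x)$, $d_q^{\ast}(x)$ the creation operator, and $G_q(x)=d_q(x)+d_q^\ast(x)$: (1) $$\langle\Omega, d_q^{\epsilon(1)}(x_1)\cdots d_q^{\epsilon(n)}(x_n)\Omega\rangle_{q}=\sum_{(\pi,f)\in\mathcal{P}^D_{2;\epsilon}(n)} q^{\mathrm{cr}(\pi)+2\,\mathrm{cnp}(\pi,f)}\prod_{\substack{\{i<j\}\in\pi\\ f(\{i<j\})=1}}\langle x_i,x_j\rangle\prod_{\substack{\{i<j\}\in\pi\\ f(\{i<j\})=-1}}\langle x_i,\overline{x}_j\rangle .$$ (2) $$\langle\Omega, G_q(x_1)\cdots G_q(x_n)\Omega\rangle_{q}=\sum_{(\pi,f)\in\mathcal{P}^D_{2}(n)} q^{\mathrm{cr}(\pi)+2\,\mathrm{cnp}(\pi,f)}\prod_{\substack{\{i<j\}\in\pi\\ f(\{i<j\})=1}}\langle x_i,x_j\rangle\prod_{\substack{\{i<j\}\in\pi\\ f(\{i<j\})=-1}}\langle x_i,\overline{x}_j\rangle .$$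
   Context: Fock space. $H$ is a complex Hilbert space with inner product $\langle\cdot,\cdot\rangle$ linear in the right argument and antilinear in the left one; $x\mapsto\overline{x}$ is a fixed selfadjoint involution on $H$, i.e. a bounded selfadjoint linear operator whose square is the identity. Let $B(n)$ be the group of permutations $\sigma$ of $\{\pm1,\dots,\pm n\}$ with $\sigma(-k)=-\sigma(k)$; put $\pi_i=(i,i+1)(-i,-i-1)$ for $1\le i\le n-1$, $\overline{\pi}_n=(n,-n)$ and $\widehat{\pi}_{n-1}=\overline{\pi}_n\pi_{n-1}\overline{\pi}_n$. The Coxeter group $D(n)$ of type D is $D(1)=\{e\}$ and, for $n\ge2$, the subgroup of $B(n)$ generated by $\pi_1,\dots,\pi_{n-1},\widehat{\pi}_{n-1}$; $\ell(\sigma)$ is the minimal number of these generators in a product expression of $\sigma\in D(n)$. For $n\ge 2$, $D(n)$ acts on $H^{\otimes n}$ by $\pi_i(x_1\otimes\cdots\otimes x_n)=x_1\otimes\cdots\otimes x_{i-1}\otimes x_{i+1}\otimes x_i\otimes x_{i+2}\otimes\cdots\otimes x_n$ and $\widehat{\pi}_{n-1}(x_1\otimes\cdots\otimes x_n)=x_1\otimes\cdots\otimes x_{n-2}\otimes\overline{x}_n\otimes\overline{x}_{n-1}$; $D(1)$ acts trivially on $H$. Put $\widehat{P}_q^{(n)}=\sum_{\sigma\in D(n)}q^{\ell(\sigma)}\sigma$ for $n\ge1$ and $\widehat P_q^{(0)}=I$ (convention $0^0=1$). Let $\mathcal{F}_{\rm fin}(H)=\bigoplus_{n\ge0}H^{\otimes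 n}$ be the algebraic direct sum, $H^{\otimes0}=\mathbb{C}\Omega$ with $\Omega$ a unit vector, with the usual inner product $\langle x_1\otimes\cdots\otimes x_m,y_1\otimes\cdots\otimes y_n\rangle_0=\delta_{m,n}\prod_i\langle x_i,y_i\rangle$, and $\widehat P_q=\bigoplus_n\widehat P_q^{(n)}$. For $q\in(-1,1)$, $\widehat P_q$ is known to be strictly positive, so $\langle f,g\rangle_q:=\langle f,\widehat P_q g\rangle_0$ is an inner product. The creation operator is $d_q^\ast(x)(x_1\otimes\cdots\otimes x_n)=x\otimes x_1\otimes\cdots\otimes x_n$, $d_q^\ast(x)\Omega=x$, and $d_q(x)$ is its adjoint with respect to $\langle\cdot,\cdot\rangle_q$. Combinatorics. $[n]=\{1,\dots,n\}$. $\mathcal{P}_2(n)$ is the set of pair partitions of $[n]$ (all blocks of size 2; empty if $n$ is odd). A set $A$ covers a set $B$ if there are $i,j\in A$ with $i<k<j$ for all $k\in B$. A block $W$ is on the right of a block $V$ if $\min V<\min W$. For $\pi\in\mathcal{P}_2(n)$ and $V\in\pi$: $\mathrm{cover}(V)=\#\{W\in\pi: W\text{ covers }V\}$; $\mathrm{lcr}(V)=\#\{W\in\pi:\exists i,j\in V,\ k,l\in W,\ k<i<l<j\}$; $\mathrm{cr}(\pi)=\sum_{V\in\pi}\mathrm{lcr}(V)$. For a coloring $f:\pi\to\{\pm1\}$, a pair $V$ with $f(V)=-1$ is called negative; $\mathrm{npr}(V)$ is the number of negative pairs on the right of $V$; $\mathrm{cnp}(\pi,f)=\#\{(V,W)\in\pi\times\pi: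 f(V)=-1,\ W\text{ covers }V\}$. The set $\mathcal{P}^D_2(n)$ of pair partitions of type D consists of all $(\pi,f)$ with $\pi\in\mathcal{P}_2(n)$, $f:\pi\to\{\pm1\}$, such that every $V\in\pi$ with $\mathrm{lcr}(V)=\mathrm{cover}(V)=0$ satisfies $f(V)=(-1)^{\mathrm{npr}(V)}$ (other pairs may have any color). Given $\epsilon\in\{1,\ast\}^n$, $\mathcal{P}^D_{2;\epsilon}(n)$ is the set of $(\pi,f)\in\mathcal{P}^D_2(n)$ such that $\epsilon(i)=1$ and $\epsilon(j)=\ast$ for every pair $\{i<j\}\in\pi$. Sums over the empty set are $0$. *)

theory Defs
  imports "HOL-Analysis.Analysis" "HOL-Combinatorics.Permutations"
    "HOL-Library.Disjoint_Sets" "HOL-Library.FuncSet"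
begin

section \<open>Complex Hilbert spaces\<close>

text \<open>
  The real structure (norm, metric, completeness) comes from the class \<^class>\<open>banach\<close>.
  The inner product is linear in the right and antilinear in the left argument.
\<close>

class complex_hilbert = banach +
  fixes scaleC :: "complex \<Rightarrow> 'a \<Rightarrow> 'a"
    and cinner :: "'a \<Rightarrow> 'a \<Rightarrow> complex"
  assumes scaleC_add_right: "scaleC a (x + y) = scaleC a x + scaleC a y"
    and scaleC_add_left: "scaleC (a + b) x = scaleC a x + scaleC b x"
    and scaleC_scaleC: "scaleC a (scaleC b x) = scaleC (a * b) x"
    and scaleC_of_real: "scaleC (complex_of_real r) x = r *\<^sub>R x"
    and cinner_commute: "cinner x y = cnj (cinner y x)"
    and cinner_add_right: "cinner x (y + z) = cinner x y + cinner x z"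
    and cinner_scaleC_right: "cinner x (scaleC a y) = a * cinner x y"
    and cinner_self: "cinner x x = complex_of_real ((norm x)\<^sup>2)"

definition selfadjoint_involution :: "('h::complex_hilbert \<Rightarrow> 'h) \<Rightarrow> bool" where
  "selfadjoint_involution J \<longleftrightarrow>
     bounded_linear J \<and> (\<forall>a x. J (scaleC a x) = scaleC a (J x)) \<and>
     (\<forall>x y. cinner (J x) y = cinner x (J y)) \<and> (\<forall>x. J (J x) = x)"


section \<open>The Coxeter group of type D\<close>

definition hyperoctahedral :: "nat \<Rightarrow> (int \<Rightarrow> int) set" where
  "hyperoctahedral n =
     {\<sigma>. \<sigma> permutes ({- int n..int n} - {0}) \<and> (\<forall>k. \<sigma> (- k) = - \<sigma> k)}"

definition refl_pi :: "nat \<Rightarrow> int \<Rightarrow> int" where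
  "refl_pi i = Transposition.transpose (int i) (int i + 1) \<circ> Transposition.transpose (- int i) (- int i - 1)"

definition refl_bar :: "nat \<Rightarrow> int \<Rightarrow> int" where
  "refl_bar n = Transposition.transpose (int n) (- int n)"

text \<open>The next function is applied to \<open>n\<close> and yields the generator with index \<open>n - 1\<close>.\<close>

definition refl_hat :: "nat \<Rightarrow> int \<Rightarrow> int" where
  "refl_hat n = refl_bar n \<circ> refl_pi (n - 1) \<circ> refl_bar n"

definition D_gens :: "nat \<Rightarrow> (int \<Rightarrow> int) set" where
  "D_gens n = {refl_pi i | i. 1 \<le> i \<and> i < n} \<union> (if n \<ge> 2 then {refl_hat n} else {})"

inductive_set coxeter_D :: "nat \<Rightarrow> (int \<Rightarrow> int) set" for n :: nat where
  D_id: "id \<in> coxeter_D n"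
| D_gen: "s \<in> D_gens n \<Longrightarrow> s \<in> coxeter_D n"
| D_comp: "\<sigma> \<in> coxeter_D n \<Longrightarrow> \<tau> \<in> coxeter_D n \<Longrightarrow> \<sigma> \<circ> \<tau> \<in> coxeter_D n"
| D_inv: "\<sigma> \<in> coxeter_D n \<Longrightarrow> inv \<sigma> \<in> coxeter_D n"

definition D_length :: "nat \<Rightarrow> (int \<Rightarrow> int) \<Rightarrow> nat" where
  "D_length n \<sigma> = (LEAST k. \<exists>w. set w \<subseteq> D_gens n \<and> length w = k \<and> foldr (\<circ>) w id = \<sigma>)"

text \<open>
  Action on tuples: the \<open>i\<close>-th entry of the image of \<open>(x\<^sub>1, \<dots>, x\<^sub>n)\<close> under \<open>\<sigma>\<close> is \<open>x\<^sub>k\<close> with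
  \<open>k = \<sigma>\<^sup>-\<^sup>1 i\<close>, where \<open>x\<^sub>k\<close> for \<open>k < 0\<close> means the image of \<open>x\<^sub>-\<^sub>k\<close> under the involution. The lemmas
  \<open>sact_refl_pi\<close>, \<open>sact_refl_hat\<close>, \<open>sact_id\<close> and \<open>sact_comp\<close> below show that this is the
  (unique) group action with the prescribed values on the generators.
\<close>

definition signed_nth :: "('h \<Rightarrow> 'h) \<Rightarrow> 'h list \<Rightarrow> int \<Rightarrow> 'h" where
  "signed_nth J xs k = (if k > 0 then xs ! (nat k - 1) else J (xs ! (nat (- k) - 1)))"

definition sact :: "('h \<Rightarrow> 'h) \<Rightarrow> (int \<Rightarrow> int) \<Rightarrow> 'h list \<Rightarrow> 'h list" where
  "sact J \<sigma> xs = map (\<lambda>i. signed_nth J xs (inv \<sigma> (int i + 1))) [0..<length xs]"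


section \<open>The algebraic Fock space\<close>

definition tuple_inner :: "'h::complex_hilbert list \<Rightarrow> 'h list \<Rightarrow> complex" where
  "tuple_inner xs ys =
     (if length xs = length ys then \<Prod>i<length xs. cinner (xs ! i) (ys ! i) else 0)"

text \<open>
  Tensors are modelled in the standard way as conjugate multilinear functionals: the elementary
  tensor of \<open>xs = [x\<^sub>1, \<dots>, x\<^sub>n]\<close> is the functional sending \<open>(z\<^sub>1, \<dots>, z\<^sub>n)\<close> to the product of the
  inner products of \<open>z\<^sub>i\<close> and \<open>x\<^sub>i\<close>. The algebraic direct sum of all tensor powers is then the
  space of finite linear combinations of elementary tensors of arbitrary lengths; since the
  functional of \<open>xs\<close> vanishes on tuples of a different length, components of different degree
  are independent. The vacuum is the tensor of the empty tuple.
\<close>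

type_synonym 'h tensor = "'h list \<Rightarrow> complex"

definition etens :: "'h::complex_hilbert list \<Rightarrow> 'h tensor" where
  "etens xs = (\<lambda>zs. tuple_inner zs xs)"

definition combo :: "('h list \<Rightarrow> 'h tensor) \<Rightarrow> (complex \<times> 'h list) list \<Rightarrow> 'h tensor" where
  "combo \<phi> w = (\<lambda>zs. \<Sum>(c, xs)\<leftarrow>w. c * \<phi> xs zs)"

definition Fock :: "'h::complex_hilbert tensor set" where
  "Fock = range (combo etens)"

definition vacuum :: "'h::complex_hilbert tensor" where
  "vacuum = etens []"

text \<open>
  Linear and sesquilinear extensions of maps given on elementary tensors are computed from an
  arbitrary expansion into elementary tensors; the independence of the expansion is established
  below for every map to which this is applied
  (\<open>fock_inner0_combo\<close>, \<open>creation_combo\<close>, \<open>Phat_combo\<close>).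
\<close>

definition expansion :: "'h::complex_hilbert tensor \<Rightarrow> (complex \<times> 'h list) list" where
  "expansion f = (SOME w. combo etens w = f)"

definition lin_ext ::
  "('h list \<Rightarrow> 'h tensor) \<Rightarrow> 'h::complex_hilbert tensor \<Rightarrow> 'h tensor" where
  "lin_ext \<phi> f = combo \<phi> (expansion f)"

definition fock_inner0 :: "'h::complex_hilbert tensor \<Rightarrow> 'h tensor \<Rightarrow> complex" where
  "fock_inner0 f g =
     (\<Sum>(c, xs)\<leftarrow>expansion f. \<Sum>(d, ys)\<leftarrow>expansion g. cnj c * d * tuple_inner xs ys)"

text \<open>
  On tensors of length \<open>n\<close> this is the symmetrization operator of degree \<open>n\<close>. For \<open>n \<le> 1\<close> there
  are no generators, so that it is the identity there.
\<close>

definition Phat :: "('h \<Rightarrow> 'h) \<Rightarrow> real \<Rightarrow> 'h::complex_hilbert tensor \<Rightarrow> 'h tensor" where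
  "Phat J q = lin_ext (\<lambda>xs zs. \<Sum>\<sigma>\<in>coxeter_D (length xs).
      complex_of_real (q ^ D_length (length xs) \<sigma>) * etens (sact J \<sigma> xs) zs)"

definition fock_inner ::
  "('h \<Rightarrow> 'h) \<Rightarrow> real \<Rightarrow> 'h::complex_hilbert tensor \<Rightarrow> 'h tensor \<Rightarrow> complex" where
  "fock_inner J q f g = fock_inner0 f (Phat J q g)"

definition creation :: "'h::complex_hilbert \<Rightarrow> 'h tensor \<Rightarrow> 'h tensor" where
  "creation x = lin_ext (\<lambda>xs. etens (x # xs))"

definition fock_linear :: "('h::complex_hilbert tensor \<Rightarrow> 'h tensor) \<Rightarrow> bool" where
  "fock_linear T \<longleftrightarrow> (\<forall>f\<in>Fock. T f \<in> Fock) \<and>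
     (\<forall>f\<in>Fock. \<forall>g\<in>Fock. \<forall>a b.
        T (\<lambda>zs. a * f zs + b * g zs) = (\<lambda>zs. a * T f zs + b * T g zs))"

definition is_adjoint :: "('h \<Rightarrow> 'h) \<Rightarrow> real \<Rightarrow>
    ('h::complex_hilbert tensor \<Rightarrow> 'h tensor) \<Rightarrow> ('h tensor \<Rightarrow> 'h tensor) \<Rightarrow> bool" where
  "is_adjoint J q S T \<longleftrightarrow> fock_linear T \<and>
     (\<forall>f\<in>Fock. \<forall>g\<in>Fock. fock_inner J q (S f) g = fock_inner J q f (T g))"

text \<open>
  For \<open>-1 < q < 1\<close> the operator \<^const>\<open>Phat\<close> is strictly positive, so the adjoint is unique on
  \<^const>\<open>Fock\<close>; its values outside \<^const>\<open>Fock\<close> are irrelevant.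
\<close>

definition annihilation ::
  "('h \<Rightarrow> 'h) \<Rightarrow> real \<Rightarrow> 'h::complex_hilbert \<Rightarrow> 'h tensor \<Rightarrow> 'h tensor" where
  "annihilation J q x = (SOME T. is_adjoint J q (creation x) T)"

text \<open>The exponents \<open>1\<close> and \<open>*\<close> are encoded as \<open>Ann\<close> and \<open>Cre\<close>.\<close>

datatype ladder = Ann | Cre

definition ladder_op ::
  "('h \<Rightarrow> 'h) \<Rightarrow> real \<Rightarrow> ladder \<Rightarrow> 'h::complex_hilbert \<Rightarrow> 'h tensor \<Rightarrow> 'h tensor" where
  "ladder_op J q e x = (case e of Ann \<Rightarrow> annihilation J q x | Cre \<Rightarrow> creation x)"

definition gaussian ::
  "('h \<Rightarrow> 'h) \<Rightarrow> real \<Rightarrow> 'h::complex_hilbert \<Rightarrow> 'h tensor \<Rightarrow> 'h tensor" where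
  "gaussian J q x f = (\<lambda>zs. annihilation J q x f zs + creation x f zs)"


section \<open>Pair partitions of type D\<close>

definition pair_partitions :: "nat \<Rightarrow> nat set set set" where
  "pair_partitions n = {\<pi>. partition_on {1..n} \<pi> \<and> (\<forall>V\<in>\<pi>. card V = 2)}"

definition covers :: "nat set \<Rightarrow> nat set \<Rightarrow> bool" where
  "covers A B \<longleftrightarrow> (\<exists>i\<in>A. \<exists>j\<in>A. \<forall>k\<in>B. i < k \<and> k < j)"

definition cover :: "nat set set \<Rightarrow> nat set \<Rightarrow> nat" where
  "cover \<pi> V = card {W \<in> \<pi>. covers W V}"

definition lcr :: "nat set set \<Rightarrow> nat set \<Rightarrow> nat" where
  "lcr \<pi> V = card {W \<in> \<pi>. \<exists>i\<in>V. \<exists>j\<in>V. \<exists>k\<in>W. \<exists>l\<in>W. k < i \<and> i < l \<and> l < j}"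

definition cr :: "nat set set \<Rightarrow> nat" where
  "cr \<pi> = (\<Sum>V\<in>\<pi>. lcr \<pi> V)"

definition npr :: "nat set set \<Rightarrow> (nat set \<Rightarrow> int) \<Rightarrow> nat set \<Rightarrow> nat" where
  "npr \<pi> f V = card {W \<in> \<pi>. f W = - 1 \<and> Min V < Min W}"

definition cnp :: "nat set set \<Rightarrow> (nat set \<Rightarrow> int) \<Rightarrow> nat" where
  "cnp \<pi> f = card {(V, W). V \<in> \<pi> \<and> W \<in> \<pi> \<and> f V = - 1 \<and> covers W V}"

text \<open>Colorings are extensional functions, so that each coloring of the blocks is counted once.\<close>

definition pair_partitions_D :: "nat \<Rightarrow> (nat set set \<times> (nat set \<Rightarrow> int)) set" where
  "pair_partitions_D n = {(\<pi>, f). \<pi> \<in> pair_partitions n \<and> f \<in> \<pi> \<rightarrow>\<^sub>E {1, - 1} \<and>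
     (\<forall>V\<in>\<pi>. lcr \<pi> V = 0 \<and> cover \<pi> V = 0 \<longrightarrow> f V = (- 1) ^ npr \<pi> f V)}"

definition pair_partitions_D_eps ::
  "nat \<Rightarrow> (nat \<Rightarrow> ladder) \<Rightarrow> (nat set set \<times> (nat set \<Rightarrow> int)) set" where
  "pair_partitions_D_eps n \<epsilon> = {(\<pi>, f) \<in> pair_partitions_D n.
     \<forall>V\<in>\<pi>. \<epsilon> (Min V) = Ann \<and> \<epsilon> (Max V) = Cre}"

definition pair_weight :: "('h \<Rightarrow> 'h) \<Rightarrow> real \<Rightarrow> (nat \<Rightarrow> 'h::complex_hilbert) \<Rightarrow>
    nat set set \<Rightarrow> (nat set \<Rightarrow> int) \<Rightarrow> complex" where
  "pair_weight J q x \<pi> f = complex_of_real (q ^ (cr \<pi> + 2 * cnp \<pi> f)) *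
     (\<Prod>V\<in>{V \<in> \<pi>. f V = 1}. cinner (x (Min V)) (x (Max V))) *
     (\<Prod>V\<in>{V \<in> \<pi>. f V = - 1}. cinner (x (Min V)) (J (x (Max V))))"


section \<open>Consistency of the definitions\<close>

lemma refl_pi_in_B:
  assumes "1 \<le> i" "i < n"
  shows "refl_pi i \<in> hyperoctahedral n"
proof -
  have "Transposition.transpose (int i) (int i + 1) permutes ({- int n..int n} - {0})"
    using assms by (intro permutes_swap_id) auto
  moreover have "Transposition.transpose (- int i) (- int i - 1) permutes ({- int n..int n} - {0})"
    using assms by (intro permutes_swap_id) auto
  ultimately have "refl_pi i permutes ({- int n..int n} - {0})"
    unfolding refl_pi_def using permutes_compose by blast
  moreover have "refl_pi i (- k) = - refl_pi i k" for k
    using assms by (auto simp: refl_pi_def Transposition.transpose_def)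
  ultimately show ?thesis by (simp add: hyperoctahedral_def)
qed

lemma refl_bar_in_B:
  assumes "1 \<le> n"
  shows "refl_bar n \<in> hyperoctahedral n"
proof -
  have "refl_bar n permutes ({- int n..int n} - {0})"
    unfolding refl_bar_def using assms by (intro permutes_swap_id) auto
  moreover have "refl_bar n (- k) = - refl_bar n k" for k
    using assms by (auto simp: refl_bar_def Transposition.transpose_def)
  ultimately show ?thesis by (simp add: hyperoctahedral_def)
qed

lemma B_comp:
  assumes "\<sigma> \<in> hyperoctahedral n" "\<tau> \<in> hyperoctahedral n"
  shows "\<sigma> \<circ> \<tau> \<in> hyperoctahedral n"
  using assms permutes_compose unfolding hyperoctahedral_def by auto

lemma B_inv:
  assumes "\<sigma> \<in> hyperoctahedral n"
  shows "inv \<sigma> \<in> hyperoctahedral n"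
proof -
  have p: "\<sigma> permutes ({- int n..int n} - {0})" and m: "\<And>k. \<sigma> (- k) = - \<sigma> k"
    using assms by (auto simp: hyperoctahedral_def)
  have "inv \<sigma> (- k) = - inv \<sigma> k" for k
    using m[of "inv \<sigma> k"] p by (metis permutes_inverses)
  then show ?thesis using permutes_inv[OF p] by (simp add: hyperoctahedral_def)
qed

lemma refl_hat_in_B:
  assumes "2 \<le> n"
  shows "refl_hat n \<in> hyperoctahedral n"
  unfolding refl_hat_def using assms by (intro B_comp refl_bar_in_B refl_pi_in_B) auto

lemma coxeter_D_subset_B:
  assumes "\<sigma> \<in> coxeter_D n"
  shows "\<sigma> \<in> hyperoctahedral n"
  using assms
proof induction
  case D_id
  then show ?case by (simp add: hyperoctahedral_def permutes_def id_def)
next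
  case (D_gen s)
  then show ?case
    by (auto simp: D_gens_def refl_pi_in_B refl_hat_in_B split: if_splits)
qed (simp_all only: B_comp B_inv)

lemma coxeter_D_trivial:
  assumes "n \<le> 1"
  shows "coxeter_D n = {id}"
proof -
  have "\<sigma> = id" if "\<sigma> \<in> coxeter_D n" for \<sigma>
    using that
  proof induction
    case (D_gen s)
    then show ?case using assms by (auto simp: D_gens_def)
  qed simp_all
  then show ?thesis by (auto intro: D_id)
qed

lemma B_range:
  assumes "\<sigma> \<in> hyperoctahedral n" "k \<noteq> 0" "\<bar>k\<bar> \<le> int n"
  shows "\<sigma> k \<noteq> 0" "\<bar>\<sigma> k\<bar> \<le> int n"
proof -
  have p: "\<sigma> permutes ({- int n..int n} - {0})"
    using assms by (auto simp: hyperoctahedral_def)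
  have "k \<in> {- int n..int n} - {0}" using assms by auto
  then have "\<sigma> k \<in> {- int n..int n} - {0}" using permutes_in_image[OF p] by blast
  then show "\<sigma> k \<noteq> 0" "\<bar>\<sigma> k\<bar> \<le> int n" by auto
qed

lemma length_sact [simp]: "length (sact J \<sigma> xs) = length xs"
  by (simp add: sact_def)

lemma signed_nth_sact:
  assumes J: "\<And>x. J (J x) = x" and \<sigma>: "\<sigma> \<in> hyperoctahedral (length xs)"
    and k: "k \<noteq> 0" "\<bar>k\<bar> \<le> int (length xs)"
  shows "signed_nth J (sact J \<sigma> xs) k = signed_nth J xs (inv \<sigma> k)"
proof (cases "k > 0")
  case True
  then have "nat k - 1 < length xs" "int (nat k - 1) + 1 = k" using k by auto
  then show ?thesis using True
    unfolding signed_nth_def[of J "sact J \<sigma> xs"] by (simp add: sact_def)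
next
  case False
  have B: "inv \<sigma> \<in> hyperoctahedral (length xs)" using B_inv[OF \<sigma>] .
  have m: "inv \<sigma> (- k) = - inv \<sigma> k" using B by (simp add: hyperoctahedral_def)
  have nz: "inv \<sigma> k \<noteq> 0" using B_range[OF B k] by simp
  have "signed_nth J (sact J \<sigma> xs) k = J (signed_nth J xs (inv \<sigma> (- k)))"
  proof -
    have "nat (- k) - 1 < length xs" "int (nat (- k) - 1) + 1 = - k" using False k by auto
    then show ?thesis using False
      unfolding signed_nth_def[of J "sact J \<sigma> xs"] by (simp add: sact_def)
  qed
  also have "\<dots> = signed_nth J xs (inv \<sigma> k)"
    using nz J by (auto simp: m signed_nth_def)
  finally show ?thesis .
qed

lemma sact_id: "sact J id xs = xs"
proof (rule nth_equalityI)
  fix i assume "i < length (sact J id xs)"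
  then show "sact J id xs ! i = xs ! i"
    by (simp add: sact_def signed_nth_def nat_add_distrib)
qed simp

lemma sact_comp:
  assumes J: "\<And>x. J (J x) = x"
    and \<sigma>: "\<sigma> \<in> hyperoctahedral (length xs)" and \<tau>: "\<tau> \<in> hyperoctahedral (length xs)"
  shows "sact J (\<sigma> \<circ> \<tau>) xs = sact J \<sigma> (sact J \<tau> xs)"
proof (rule nth_equalityI)
  fix i assume "i < length (sact J (\<sigma> \<circ> \<tau>) xs)"
  then have i: "i < length xs" by simp
  have bij: "bij \<sigma>" "bij \<tau>"
    using \<sigma> \<tau> by (auto simp: hyperoctahedral_def permutes_bij)
  have r: "inv \<sigma> (int i + 1) \<noteq> 0" "\<bar>inv \<sigma> (int i + 1)\<bar> \<le> int (length xs)"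
    using B_range[OF B_inv[OF \<sigma>], of "int i + 1"] i by auto
  show "sact J (\<sigma> \<circ> \<tau>) xs ! i = sact J \<sigma> (sact J \<tau> xs) ! i"
    using i signed_nth_sact[OF J \<tau> r] bij
    by (simp add: sact_def[of J "\<sigma> \<circ> \<tau>"] sact_def[of J \<sigma>] o_inv_distrib)
qed simp

lemma sact_refl_pi:
  assumes "1 \<le> i" "i < length xs"
  shows "sact J (refl_pi i) xs = xs[i - 1 := xs ! i, i := xs ! (i - 1)]"
proof (rule nth_equalityI)
  have inv: "inv (refl_pi i) = refl_pi i"
    using assms by (intro inv_unique_comp) (auto simp: refl_pi_def Transposition.transpose_def fun_eq_iff)
  fix j assume "j < length (sact J (refl_pi i) xs)"
  then have j: "j < length xs" by simp
  have s: "sact J (refl_pi i) xs ! j = signed_nth J xs (refl_pi i (int j + 1))"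
    using j by (simp add: sact_def inv)
  consider "j = i - 1" | "j = i" | "j \<noteq> i - 1" "j \<noteq> i" by blast
  then show "sact J (refl_pi i) xs ! j = xs[i - 1 := xs ! i, i := xs ! (i - 1)] ! j"
  proof cases
    case 1
    then have "refl_pi i (int j + 1) = int i + 1"
      using assms by (auto simp: refl_pi_def Transposition.transpose_def)
    with 1 s assms show ?thesis
      by (simp add: signed_nth_def nat_add_distrib)
  next
    case 2
    then have "refl_pi i (int j + 1) = int i"
      using assms by (auto simp: refl_pi_def Transposition.transpose_def)
    with 2 s assms show ?thesis by (simp add: signed_nth_def)
  next
    case 3
    then have "refl_pi i (int j + 1) = int j + 1"
      using assms by (auto simp: refl_pi_def Transposition.transpose_def)
    with 3 s show ?thesis using j by (simp add: signed_nth_def nat_add_distrib)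
  qed
qed simp

lemma sact_refl_hat:
  assumes "n = length xs" "2 \<le> n"
  shows "sact J (refl_hat n) xs = xs[n - 2 := J (xs ! (n - 1)), n - 1 := J (xs ! (n - 2))]"
proof (rule nth_equalityI)
  have v: "refl_hat n k = (if k = int n then - (int n - 1) else if k = int n - 1 then - int n
      else if k = - int n then int n - 1 else if k = - (int n - 1) then int n else k)" for k
    using assms by (auto simp: refl_hat_def refl_bar_def refl_pi_def Transposition.transpose_def of_nat_diff)
  have "refl_hat n (refl_hat n k) = k" for k
    unfolding v using assms by (auto split: if_splits)
  then have inv: "inv (refl_hat n) = refl_hat n"
    by (intro inv_unique_comp) (auto simp: fun_eq_iff)
  fix j assume "j < length (sact J (refl_hat n) xs)"
  then have j: "j < n" using assms by simp
  have s: "sact J (refl_hat n) xs ! j = signed_nth J xs (refl_hat n (int j + 1))"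
    using j inv assms(1) by (simp add: sact_def)
  consider "j = n - 2" | "j = n - 1" | "j \<noteq> n - 2" "j \<noteq> n - 1" by blast
  then show "sact J (refl_hat n) xs ! j =
      xs[n - 2 := J (xs ! (n - 1)), n - 1 := J (xs ! (n - 2))] ! j"
  proof cases
    case 1
    then have "refl_hat n (int j + 1) = - int n" unfolding v using assms by auto
    with 1 s assms show ?thesis by (simp add: signed_nth_def)
  next
    case 2
    then have "refl_hat n (int j + 1) = - int (n - 1)" unfolding v using assms by auto
    then have "\<not> refl_hat n (int j + 1) > 0" "nat (- refl_hat n (int j + 1)) - 1 = n - 2"
      using assms by auto
    with 2 assms show ?thesis unfolding s signed_nth_def by simp
  next
    case 3
    then have "refl_hat n (int j + 1) = int j + 1" unfolding v using j assms by auto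
    with 3 s show ?thesis using j by (simp add: signed_nth_def nat_add_distrib)
  qed
qed simp

lemma cinner_add_left: "cinner (x + y) z = cinner x z + cinner y (z::'h::complex_hilbert)"
  by (metis cinner_commute cinner_add_right complex_cnj_add)

lemma cinner_scaleC_left: "cinner (scaleC a x) y = cnj a * cinner x (y::'h::complex_hilbert)"
  by (metis cinner_commute cinner_scaleC_right complex_cnj_mult)

lemma tuple_inner_commute: "tuple_inner xs ys = cnj (tuple_inner ys xs)"
  by (auto simp: tuple_inner_def intro!: prod.cong) (metis cinner_commute)

lemma etens_slot:
  "etens (xs @ u # ys) zs = (if length zs = length xs + Suc (length ys)
     then cinner (zs ! length xs) u * (\<Prod>i\<in>{..<length xs + Suc (length ys)} - {length xs}.
       cinner (zs ! i) ((xs @ undefined # ys) ! i)) else 0)"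
proof -
  let ?n = "length xs + Suc (length ys)" and ?i = "length xs"
  have "(\<Prod>i<?n. cinner (zs ! i) ((xs @ u # ys) ! i)) = cinner (zs ! ?i) u *
      (\<Prod>i\<in>{..<?n} - {?i}. cinner (zs ! i) ((xs @ u # ys) ! i))"
    by (subst prod.remove[of _ ?i]) auto
  also have "(\<Prod>i\<in>{..<?n} - {?i}. cinner (zs ! i) ((xs @ u # ys) ! i)) =
      (\<Prod>i\<in>{..<?n} - {?i}. cinner (zs ! i) ((xs @ undefined # ys) ! i))"
    by (intro prod.cong) (auto simp: nth_append nth_Cons split: nat.splits)
  finally show ?thesis by (simp add: etens_def tuple_inner_def del: add_Suc_right)
qed

lemma etens_add:
  "etens (xs @ (x + y) # ys) = (\<lambda>zs. etens (xs @ x # ys) zs + etens (xs @ y # ys) zs)"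
  by (auto simp: fun_eq_iff etens_slot[of xs] cinner_add_right distrib_right)

lemma etens_scaleC: "etens (xs @ scaleC a x # ys) = (\<lambda>zs. a * etens (xs @ x # ys) zs)"
  by (auto simp: fun_eq_iff etens_slot[of xs] cinner_scaleC_right)

lemma combo_expansion: "combo etens (expansion (combo etens w)) = combo etens w"
  unfolding expansion_def by (rule someI) (rule refl)

lemma lin_ext_combo:
  assumes "\<And>w. combo \<phi> w = \<Psi> (combo etens w)"
  shows "lin_ext \<phi> (combo etens w) = combo \<phi> w"
  by (simp add: lin_ext_def assms combo_expansion)

lemma fock_inner0_combo:
  "fock_inner0 (combo etens v) (combo etens w) =
     (\<Sum>(c, xs)\<leftarrow>v. \<Sum>(d, ys)\<leftarrow>w. cnj c * d * tuple_inner xs ys)"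
proof -
  have r: "(\<Sum>(c, xs)\<leftarrow>v. \<Sum>(d, ys)\<leftarrow>w. cnj c * d * tuple_inner xs ys) =
      (\<Sum>(c, xs)\<leftarrow>v. cnj c * combo etens w xs)"
    for v w :: "(complex \<times> 'a list) list"
    by (auto simp: combo_def etens_def sum_list_const_mult[symmetric] case_prod_unfold mult.assoc
        intro!: arg_cong[of _ _ sum_list] map_cong)
  have l: "(\<Sum>(c, xs)\<leftarrow>v. cnj c * combo etens w xs) =
      (\<Sum>(d, ys)\<leftarrow>w. d * cnj (combo etens v ys))"
    for v w :: "(complex \<times> 'a list) list"
  proof (induction v)
    case Nil
    then show ?case by (induction w) (auto simp: combo_def)
  next
    case (Cons a v)
    obtain c xs where a: "a = (c, xs)" by fastforce
    have "cnj c * combo etens w xs = (\<Sum>(d, ys)\<leftarrow>w. d * cnj (c * etens xs ys))"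
      unfolding combo_def etens_def
      by (induction w) (auto simp: algebra_simps tuple_inner_commute[of xs])
    then have "(\<Sum>(c, xs)\<leftarrow>a # v. cnj c * combo etens w xs) =
        (\<Sum>(d, ys)\<leftarrow>w. d * cnj (c * etens xs ys)) + (\<Sum>(d, ys)\<leftarrow>w. d * cnj (combo etens v ys))"
      using Cons.IH by (simp add: a)
    also have "\<dots> = (\<Sum>(d, ys)\<leftarrow>w. d * cnj (combo etens (a # v) ys))"
      by (simp add: a combo_def case_prod_unfold sum_list_addf[symmetric] algebra_simps)
    finally show ?case .
  qed
  show ?thesis
    unfolding fock_inner0_def r combo_expansion l unfolding combo_expansion unfolding l[symmetric] ..
qed

lemma creation_combo:
  "creation x (combo etens w) = combo (\<lambda>xs. etens (x # xs)) w"
  unfolding creation_def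
proof (rule lin_ext_combo)
  fix w :: "(complex \<times> 'a list) list"
  have "etens (x # xs) = (\<lambda>zs. case zs of [] \<Rightarrow> 0 | z # zs \<Rightarrow> cinner z x * etens xs zs)" for xs
    by (auto simp: fun_eq_iff etens_def tuple_inner_def prod.lessThan_Suc_shift
        simp del: prod.lessThan_Suc split: list.splits)
  then show "combo (\<lambda>xs. etens (x # xs)) w =
      (\<lambda>f zs. case zs of [] \<Rightarrow> 0 | z # zs \<Rightarrow> cinner z x * f zs) (combo etens w)"
    by (auto simp: fun_eq_iff combo_def case_prod_unfold sum_list_const_mult[symmetric]
        algebra_simps split: list.splits)
qed

lemma tuple_inner_sact:
  assumes J: "selfadjoint_involution J" and \<sigma>: "\<sigma> \<in> hyperoctahedral (length xs)"
    and len: "length zs = length xs"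
  shows "tuple_inner (sact J \<sigma> zs) (sact J \<sigma> xs) = tuple_inner zs xs"
proof -
  let ?n = "length xs" and ?h = "\<lambda>i. nat \<bar>inv \<sigma> (int i + 1)\<bar> - 1"
  have B: "inv \<sigma> \<in> hyperoctahedral ?n" using B_inv[OF \<sigma>] .
  have m: "\<And>k. inv \<sigma> (- k) = - inv \<sigma> k" and p: "inv \<sigma> permutes ({- int ?n..int ?n} - {0})"
    using B by (auto simp: hyperoctahedral_def)
  have JJ: "cinner (J u) (J v) = cinner u v" for u v
    using J unfolding selfadjoint_involution_def by metis
  have r: "inv \<sigma> (int i + 1) \<noteq> 0" "\<bar>inv \<sigma> (int i + 1)\<bar> \<le> int ?n" if "i < ?n" for i
    using B_range[OF B, of "int i + 1"] that by auto
  have abs_eq: "\<bar>a\<bar> = \<bar>b\<bar>" if "nat \<bar>a\<bar> - 1 = nat \<bar>b\<bar> - 1" "a \<noteq> 0" "b \<noteq> 0" for a b :: int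
  proof -
    have "nat \<bar>a\<bar> > 0" "nat \<bar>b\<bar> > 0" using that by auto
    then have "nat \<bar>a\<bar> = nat \<bar>b\<bar>" using that(1) by linarith
    then show ?thesis by simp
  qed
  have inj: "inj_on ?h {..<?n}"
  proof
    fix i j assume ij: "i \<in> {..<?n}" "j \<in> {..<?n}" and e: "?h i = ?h j"
    have "\<bar>inv \<sigma> (int i + 1)\<bar> = \<bar>inv \<sigma> (int j + 1)\<bar>"
      by (rule abs_eq[OF e]) (use r[of i] r[of j] ij in simp_all)
    then consider "inv \<sigma> (int i + 1) = inv \<sigma> (int j + 1)"
      | "inv \<sigma> (int i + 1) = inv \<sigma> (- (int j + 1))"
      unfolding m abs_eq_iff by blast
    then have "int i + 1 = int j + 1 \<or> int i + 1 = - (int j + 1)"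
      using permutes_inj[OF p] by cases (blast dest: injD)+
    then show "i = j" by auto
  qed
  have sub: "?h ` {..<?n} \<subseteq> {..<?n}"
  proof
    fix y assume "y \<in> ?h ` {..<?n}"
    then obtain i where "i < ?n" "y = ?h i" by auto
    then show "y \<in> {..<?n}" using r[of i] by auto
  qed
  have bij: "bij_betw ?h {..<?n} {..<?n}"
    using inj endo_inj_surj[OF _ sub inj] by (auto simp: bij_betw_def)
  have "tuple_inner (sact J \<sigma> zs) (sact J \<sigma> xs) =
      (\<Prod>i<?n. cinner (zs ! ?h i) (xs ! ?h i))"
    using r len by (auto simp: tuple_inner_def sact_def signed_nth_def JJ intro!: prod.cong)
  also have "\<dots> = (\<Prod>i<?n. cinner (zs ! i) (xs ! i))"
    by (rule prod.reindex_bij_betw[OF bij])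
  finally show ?thesis using len by (simp add: tuple_inner_def)
qed

lemma etens_sact:
  assumes J: "selfadjoint_involution J" and \<sigma>: "\<sigma> \<in> hyperoctahedral (length xs)"
  shows "etens (sact J \<sigma> xs) zs = etens xs (sact J (inv \<sigma>) zs)"
proof (cases "length zs = length xs")
  case True
  have JJ: "\<And>x. J (J x) = x" using J by (simp add: selfadjoint_involution_def)
  have "bij \<sigma>" using \<sigma> by (auto simp: hyperoctahedral_def permutes_bij)
  then have "\<sigma> \<circ> inv \<sigma> = id" using bij_is_surj surj_iff by blast
  then have "zs = sact J \<sigma> (sact J (inv \<sigma>) zs)"
    using sact_comp[of J \<sigma> zs "inv \<sigma>", OF JJ] \<sigma> B_inv[OF \<sigma>] True by (simp add: sact_id)
  then show ?thesis
    using tuple_inner_sact[OF J \<sigma>, of "sact J (inv \<sigma>) zs"] True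
    by (simp add: etens_def)
qed (simp add: etens_def tuple_inner_def)

lemma Phat_combo:
  assumes J: "selfadjoint_involution J"
  shows "Phat J q (combo etens w) = combo (\<lambda>xs zs. \<Sum>\<sigma>\<in>coxeter_D (length xs).
      complex_of_real (q ^ D_length (length xs) \<sigma>) * etens (sact J \<sigma> xs) zs) w"
  unfolding Phat_def
proof (rule lin_ext_combo)
  fix w :: "(complex \<times> 'a list) list"
  let ?\<Psi> = "\<lambda>f zs. \<Sum>\<sigma>\<in>coxeter_D (length zs).
      complex_of_real (q ^ D_length (length zs) \<sigma>) * f (sact J (inv \<sigma>) zs)"
  have e: "(\<Sum>\<sigma>\<in>coxeter_D (length xs).
      complex_of_real (q ^ D_length (length xs) \<sigma>) * etens (sact J \<sigma> xs) zs) = ?\<Psi> (etens xs) zs"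
    for xs zs
  proof (cases "length zs = length xs")
    case True
    then show ?thesis
      by (auto intro!: sum.cong etens_sact[OF J] coxeter_D_subset_B)
  qed (simp add: etens_def tuple_inner_def)
  show "combo (\<lambda>xs zs. \<Sum>\<sigma>\<in>coxeter_D (length xs).
      complex_of_real (q ^ D_length (length xs) \<sigma>) * etens (sact J \<sigma> xs) zs) w =
      ?\<Psi> (combo etens w)"
    unfolding e
    by (induction w) (auto simp: combo_def fun_eq_iff sum_distrib_left sum.distrib algebra_simps)
qed

end

theory Submission
  imports Defs
begin

text \<open>
  The vacuum functional reads off the coefficient of the empty tensor, so the task is to follow
  how a word in creation and annihilation operators, read from the right, acts on elementary
  tensors, and to recognise the resulting paths as coloured pair partitions.

  \<^bold>\<open>The annihilation operator.\<close> The elements of \<open>D(n+1)\<close> that fix \<open>1\<close> form a copy of \<open>D(n)\<close>. Its right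
  cosets have the representatives \<open>w\<^sub>k\<close>, where \<open>k\<close> is the signed position whose vector \<open>w\<^sub>k\<close> moves to
  the front. Lengths add along this factorisation (\<open>D_length_factor\<close>), and so the symmetrization
  operator factors as \<open>(1 \<otimes> P\<^sub>n) \<circ> R\<close>, where \<open>R\<close> is the sum of the \<open>w\<^sub>k\<close> weighted by \<open>q\<close> to their
  length. Contracting the front vector of \<open>R\<close> with \<open>x\<close> is then adjoint to tensoring with \<open>x\<close>
  (\<open>is_adjoint_annih\<close>). The length of \<open>w\<^sub>k\<close> is \<open>k - 1\<close> for \<open>k > 0\<close> and \<open>2n + 1 + k\<close> for \<open>k < 0\<close>; for
  negative \<open>k\<close> the involution hits the contracted vector and also the last of the remaining ones.

  \<^bold>\<open>Independence of the choice of adjoint.\<close> Two adjoints of the creation operator differ by an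
  operator with values in the radical of the hermitian form, and both the creation operator and
  all its adjoints preserve that radical. Hence vacuum expectations may be computed with the
  explicit adjoint (\<open>vacuum_expectation\<close>).

  \<^bold>\<open>Combinatorics.\<close> Starting from the vacuum, every tensor that occurs consists of the vectors
  that still wait for a partner, in increasing order of position, with the involution possibly
  applied to the last one. This one bit is the parity of the number of negative pairs
  formed so far. Annihilating at position \<open>i\<close> pairs \<open>i\<close> with a waiting position \<open>j\<close>; the waiting
  positions below \<open>j\<close> will become left crossings of the new pair and those above \<open>j\<close> will cover
  it. A negative pair thus costs the exponent \<open>lcr + 2 cover\<close>, a positive one \<open>lcr\<close>. If \<open>j\<close> is the
  only waiting position, i.e. if nothing crosses from the left or covers, there is only one coset,
  and the colour is forced to be the current parity: this is the defining condition of type D.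
  Reading the pair partition from its largest minimum, the same recursion holds for the sums over
  pair partitions (\<open>sum_completions_Suc\<close>), and \<open>vev_state\<close> matches the two.

  Giving the two summands of the operator at position \<open>i\<close> arbitrary coefficients treats the words
  and the Gaussian operators at once.
\<close>

section \<open>Coset representatives and length in the Coxeter group of type D\<close>

definition up :: "int \<Rightarrow> int" where "up k = (if k > 0 then k + 1 else if k < 0 then k - 1 else 0)"
definition down :: "int \<Rightarrow> int" where "down k = (if k > 0 then k - 1 else if k < 0 then k + 1 else 0)"

text \<open>
  The embedding of the signed permutations of \<open>m\<close> letters as those of \<open>m + 1\<close> letters that fix \<open>1\<close>;
  \<open>up\<close> and \<open>down\<close> move a nonzero integer away from and towards \<open>0\<close>.
\<close>

definition shift_perm :: "(int \<Rightarrow> int) \<Rightarrow> int \<Rightarrow> int" where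
  "shift_perm \<tau> k = (if \<bar>k\<bar> \<le> 1 then k else up (\<tau> (down k)))"

text \<open>
  The cycle that moves the letter \<open>m\<close> to the front and keeps the order of the others.
\<close>

definition to_front :: "int \<Rightarrow> int \<Rightarrow> int" where
  "to_front m k = (if k = m then 1 else if k = - m then - 1 else if \<bar>k\<bar> < m then up k else k)"

definition flip_ends :: "nat \<Rightarrow> int \<Rightarrow> int" where
  "flip_ends n k = (if \<bar>k\<bar> = 1 \<or> \<bar>k\<bar> = int n then - k else k)"

text \<open>
  The representative that sends the signed letter \<open>k\<close> to \<open>1\<close>. An element of \<open>D(n)\<close> changes an even
  number of signs; the shortest way to make up for the sign change at \<open>k\<close> is one at the last place.
\<close>

definition coset_rep :: "nat \<Rightarrow> int \<Rightarrow> int \<Rightarrow> int" where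
  "coset_rep n k = (if k > 0 then to_front k else flip_ends n \<circ> to_front (- k))"

definition coset_len :: "nat \<Rightarrow> int \<Rightarrow> nat" where
  "coset_len n k = (if k > 0 then nat (k - 1) else nat (2 * int n - 1 + k))"

text \<open>
  In \<open>D(1)\<close> no sign can be changed, so that there is only one coset.
\<close>

definition coset_idx :: "nat \<Rightarrow> int set" where
  "coset_idx n = (if n = 1 then {1} else {- int n..int n} - {0})"

lemma refl_pi_val: "1 \<le> i \<Longrightarrow> refl_pi i k = (if \<bar>k\<bar> = int i then up k else if \<bar>k\<bar> = int i + 1 then down k else k)"
  by (auto simp: refl_pi_def Transposition.transpose_def up_def down_def)

lemma refl_hat_val: "n \<ge> 2 \<Longrightarrow> refl_hat n k = (if \<bar>k\<bar> = int n then - down k else if \<bar>k\<bar> = int n - 1 then - up k else k)"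
  by (auto simp: refl_hat_def refl_bar_def refl_pi_def Transposition.transpose_def up_def down_def of_nat_diff)

lemma refl_pi_refl_pi: "1 \<le> i \<Longrightarrow> refl_pi i (refl_pi i k) = k"
  by (auto simp: refl_pi_val up_def down_def sgn_if)

lemma refl_hat_refl_hat: "2 \<le> n \<Longrightarrow> refl_hat n (refl_hat n k) = k"
  by (auto simp: refl_hat_val up_def down_def sgn_if)

lemma D_gens_cases:
  assumes "s \<in> D_gens n"
  obtains i where "1 \<le> i" "i < n" "s = refl_pi i" | "2 \<le> n" "s = refl_hat n"
  using assms by (auto simp: D_gens_def split: if_splits)

lemma D_gens_involution: "s \<in> D_gens n \<Longrightarrow> s \<circ> s = id"
  by (auto elim!: D_gens_cases simp: fun_eq_iff refl_pi_refl_pi refl_hat_refl_hat)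

text \<open>
  The products of words in terms of which \<^const>\<open>D_length\<close> is defined.
\<close>

definition word_prod :: "('a \<Rightarrow> 'a) list \<Rightarrow> 'a \<Rightarrow> 'a" where
  "word_prod w = foldr (\<circ>) w id"

lemma word_prod_simps [simp]: "word_prod [] = id" "word_prod (s # w) = s \<circ> word_prod w"
  by (simp_all add: word_prod_def)

lemma word_prod_append [simp]: "word_prod (v @ w) = word_prod v \<circ> word_prod w"
  by (induction v) (simp_all add: comp_assoc)

lemma word_prod_rev:
  assumes "set w \<subseteq> D_gens n"
  shows "word_prod (rev w) \<circ> word_prod w = id"
  using assms
proof (induction w)
  case (Cons s w)
  then have "s \<in> D_gens n" "set w \<subseteq> D_gens n" by simp_all
  from D_gens_involution[OF this(1)] Cons.IH[OF this(2)]
  have s: "s \<circ> s = id" and IH: "word_prod (rev w) \<circ> word_prod w = id" .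
  have "word_prod (rev (s # w)) \<circ> word_prod (s # w) = word_prod (rev w) \<circ> (s \<circ> s) \<circ> word_prod w"
    by (simp add: comp_assoc)
  then show ?case unfolding s comp_id IH .
qed simp

lemma inv_word:
  assumes "set w \<subseteq> D_gens n" shows "inv (word_prod w) = word_prod (rev w)"
  using word_prod_rev[OF assms] word_prod_rev[of "rev w" n] assms by (intro inv_unique_comp) auto

lemma coxeter_D_word: "\<sigma> \<in> coxeter_D n \<longleftrightarrow> (\<exists>w. set w \<subseteq> D_gens n \<and> word_prod w = \<sigma>)"
proof
  assume "\<sigma> \<in> coxeter_D n"
  then show "\<exists>w. set w \<subseteq> D_gens n \<and> word_prod w = \<sigma>"
  proof induction
    case D_id then show ?case by (intro exI[of _ "[]"]) auto
  next
    case (D_gen s) then show ?case by (intro exI[of _ "[s]"]) auto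
  next
    case (D_comp \<sigma> \<tau>)
    then obtain v w where "set v \<subseteq> D_gens n" "word_prod v = \<sigma>" "set w \<subseteq> D_gens n" "word_prod w = \<tau>"
      by blast
    then show ?case by (intro exI[of _ "v @ w"]) auto
  next
    case (D_inv \<sigma>)
    then obtain w where w: "set w \<subseteq> D_gens n" "word_prod w = \<sigma>" by blast
    then have "inv \<sigma> = word_prod (rev w)" using inv_word by blast
    with w(1) show ?case by (intro exI[of _ "rev w"]) auto
  qed
next
  assume "\<exists>w. set w \<subseteq> D_gens n \<and> word_prod w = \<sigma>"
  then obtain w where "set w \<subseteq> D_gens n" "word_prod w = \<sigma>" by blast
  then show "\<sigma> \<in> coxeter_D n"
  proof (induction w arbitrary: \<sigma>)
    case Nil
    then have "\<sigma> = id" by (metis word_prod_simps(1))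
    then show ?case by (simp only: D_id)
  next
    case (Cons s w)
    then have "s \<in> D_gens n" "word_prod w \<in> coxeter_D n" by simp_all
    then have "s \<circ> word_prod w \<in> coxeter_D n" by (intro D_comp[OF D_gen])
    then show ?case using Cons.prems by (simp only: word_prod_simps)
  qed
qed

lemma D_length_le: "set w \<subseteq> D_gens n \<Longrightarrow> D_length n (word_prod w) \<le> length w"
  unfolding D_length_def word_prod_def[symmetric] by (rule Least_le) auto

lemma D_length_word:
  assumes "\<sigma> \<in> coxeter_D n"
  obtains w where "set w \<subseteq> D_gens n" "word_prod w = \<sigma>" "length w = D_length n \<sigma>"
proof -
  have "\<exists>k w. set w \<subseteq> D_gens n \<and> length w = k \<and> word_prod w = \<sigma>"
    using assms by (auto simp: coxeter_D_word)
  from LeastI_ex[OF this] show ?thesis using that unfolding D_length_def word_prod_def[symmetric] by blast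
qed

lemma D_length_comp_gen:
  assumes "\<sigma> \<in> coxeter_D n" "s \<in> D_gens n"
  shows "D_length n (\<sigma> \<circ> s) \<le> D_length n \<sigma> + 1"
proof -
  from assms(1) obtain w where w: "set w \<subseteq> D_gens n" "word_prod w = \<sigma>" "length w = D_length n \<sigma>"
    by (rule D_length_word)
  have "\<sigma> \<circ> s = word_prod (w @ [s])" using w by simp
  then show ?thesis using D_length_le[of "w @ [s]" n] w assms by simp
qed

lemma D_length_inv_le: "\<sigma> \<in> coxeter_D n \<Longrightarrow> D_length n (inv \<sigma>) \<le> D_length n \<sigma>"
  by (metis D_length_le D_length_word inv_word length_rev set_rev)

lemma coxeter_D_bij: "\<sigma> \<in> coxeter_D n \<Longrightarrow> bij \<sigma>"
  using coxeter_D_subset_B[of \<sigma> n] by (auto simp: hyperoctahedral_def permutes_bij)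

lemma D_length_inv: "\<sigma> \<in> coxeter_D n \<Longrightarrow> D_length n (inv \<sigma>) = D_length n \<sigma>"
  using D_length_inv_le[of \<sigma> n] D_length_inv_le[of "inv \<sigma>" n]
  by (simp add: coxeter_D.D_inv inv_inv_eq coxeter_D_bij)

lemma D_length_0: "D_length n id = 0"
  using D_length_le[of "[]" n] by simp

lemma hyperoctahedral_0: "\<tau> \<in> hyperoctahedral m \<Longrightarrow> \<tau> k = 0 \<longleftrightarrow> k = 0"
proof -
  assume a: "\<tau> \<in> hyperoctahedral m"
  then have p: "\<tau> permutes ({- int m..int m} - {0})" by (simp add: hyperoctahedral_def)
  then have "\<tau> 0 = 0" by (auto simp: permutes_def)
  then show ?thesis using permutes_inj[OF p] by (metis injD)
qed

lemma down_up [simp]: "down (up k) = k" "\<bar>k\<bar> \<noteq> 1 \<Longrightarrow> up (down k) = k" "down k = 0 \<longleftrightarrow> \<bar>k\<bar> \<le> 1"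
  "k \<noteq> 0 \<Longrightarrow> \<not> \<bar>up k\<bar> \<le> 1"
  by (auto simp: up_def down_def sgn_if)

lemma shift_perm_comp:
  assumes "\<sigma> \<in> hyperoctahedral m" "\<tau> \<in> hyperoctahedral m"
  shows "shift_perm (\<sigma> \<circ> \<tau>) = shift_perm \<sigma> \<circ> shift_perm \<tau>"
  using assms by (auto simp: fun_eq_iff shift_perm_def hyperoctahedral_0)

lemma shift_perm_id [simp]: "shift_perm id = id"
  by (auto simp: fun_eq_iff shift_perm_def)

lemma shift_perm_gen:
  assumes "s \<in> D_gens m" shows "shift_perm s \<in> D_gens (Suc m)"
  using assms
proof (cases rule: D_gens_cases)
  case (1 i)
  then have "shift_perm s = refl_pi (Suc i)"
    by (auto simp: fun_eq_iff shift_perm_def refl_pi_val up_def down_def sgn_if)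
  then show ?thesis using 1 by (auto simp: D_gens_def)
next
  case 2
  then have "shift_perm s = refl_hat (Suc m)"
    by (auto simp: fun_eq_iff shift_perm_def refl_hat_val up_def down_def sgn_if)
  then show ?thesis using 2 by (auto simp: D_gens_def)
qed

lemma D_gens_B: "s \<in> D_gens m \<Longrightarrow> s \<in> hyperoctahedral m"
  by (intro coxeter_D_subset_B D_gen)

lemma shift_word:
  assumes "set w \<subseteq> D_gens m"
  shows "shift_perm (word_prod w) = word_prod (map shift_perm w)"
  using assms
proof (induction w)
  case (Cons s w)
  then have "word_prod w \<in> hyperoctahedral m" by (intro coxeter_D_subset_B) (auto simp: coxeter_D_word)
  then have "shift_perm (s \<circ> word_prod w) = shift_perm s \<circ> shift_perm (word_prod w)"
    using Cons.prems by (intro shift_perm_comp[OF D_gens_B]) auto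
  moreover have "shift_perm (word_prod w) = word_prod (map shift_perm w)" using Cons by auto
  ultimately show ?case by (simp only: list.map word_prod_simps)
qed simp

lemma shift_perm_eqD:
  assumes "\<sigma> \<in> hyperoctahedral m" "\<tau> \<in> hyperoctahedral m" "shift_perm \<sigma> = shift_perm \<tau>"
  shows "\<sigma> = \<tau>"
proof
  fix k
  show "\<sigma> k = \<tau> k"
  proof (cases "k = 0")
    case True then show ?thesis using assms(1,2)[THEN hyperoctahedral_0, of k] by simp
  next
    case False
    then show ?thesis using fun_cong[OF assms(3), of "up k"] by (simp add: shift_perm_def) (metis down_up(1))
  qed
qed

definition odd_map :: "(int \<Rightarrow> int) \<Rightarrow> bool" where
  "odd_map f \<longleftrightarrow> (\<forall>k. f (- k) = - f k)"

lemma odd_map_comp: "odd_map f \<Longrightarrow> odd_map g \<Longrightarrow> odd_map (f \<circ> g)"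
  by (simp add: odd_map_def)

text \<open>
  Signed permutations are odd functions, so an identity between them needs to be checked on
  positive arguments only. This keeps the case distinctions below small.
\<close>

lemma odd_map_ext:
  assumes "odd_map f" "odd_map g" "\<And>k. k > 0 \<Longrightarrow> f k = g k"
  shows "f = g"
proof
  fix k :: int
  have "f 0 = 0" "g 0 = 0" using assms(1,2) unfolding odd_map_def by (metis add.inverse_neutral neg_equal_zero)+
  moreover have "f k = g k" if "k < 0"
    using assms(3)[of "- k"] assms(1,2) that by (simp add: odd_map_def)
  ultimately show "f k = g k" using assms(3)[of k] by (cases k "0 :: int" rule: linorder_cases) auto
qed

lemma odd_map_gens: "s \<in> D_gens n \<Longrightarrow> odd_map s"
  using D_gens_B by (simp add: odd_map_def hyperoctahedral_def)

lemma odd_map_to_front: "1 \<le> m \<Longrightarrow> odd_map (to_front m)"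
  by (auto simp: odd_map_def to_front_def up_def)

lemma odd_map_flip_ends: "odd_map (flip_ends n)"
  by (auto simp: odd_map_def flip_ends_def)

lemma odd_map_pi: "1 \<le> i \<Longrightarrow> odd_map (refl_pi i)"
  using refl_pi_in_B[of i "Suc i"] by (simp add: odd_map_def hyperoctahedral_def)

lemma odd_map_hat: "2 \<le> n \<Longrightarrow> odd_map (refl_hat n)"
  using refl_hat_in_B[of n] by (simp add: odd_map_def hyperoctahedral_def)

lemmas odd_maps = odd_map_comp odd_map_to_front odd_map_flip_ends odd_map_pi odd_map_hat

lemma to_front_pos: "1 \<le> m \<Longrightarrow> 0 < k \<Longrightarrow> to_front m k = (if k = m then 1 else if k < m then k + 1 else k)"
  by (simp add: to_front_def up_def)

lemma to_front_minus: "1 \<le> m \<Longrightarrow> to_front m (- k) = - to_front m k"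
  using odd_map_to_front by (simp add: odd_map_def)

lemma refl_pi_pos: "1 \<le> i \<Longrightarrow> 0 < k \<Longrightarrow> refl_pi i k = (if k = int i then k + 1 else if k = int i + 1 then k - 1 else k)"
  by (simp add: refl_pi_val up_def down_def)

lemma refl_hat_pos: "2 \<le> n \<Longrightarrow> 0 < k \<Longrightarrow> refl_hat n k = (if k = int n then - (k - 1) else if k = int n - 1 then - (k + 1) else k)"
  by (simp add: refl_hat_val up_def down_def)

lemma refl_hat_minus: "2 \<le> n \<Longrightarrow> refl_hat n (- k) = - refl_hat n k"
  using odd_map_hat by (simp add: odd_map_def)

lemma flip_ends_minus: "flip_ends n (- k) = - flip_ends n k"
  by (simp add: flip_ends_def)

lemma refl_pi_minus: "1 \<le> i \<Longrightarrow> refl_pi i (- k) = - refl_pi i k"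
  using odd_map_pi by (simp add: odd_map_def)

lemma flip_ends_pos: "0 < k \<Longrightarrow> flip_ends n k = (if k = 1 \<or> k = int n then - k else k)"
  by (simp add: flip_ends_def)

text \<open>
  How the cycles interact with the generators: a generator that moves the letter \<open>m\<close> changes the
  cycle into a neighbouring one, up to the sign change at both ends for the generator of negative
  type. Every other generator can be moved to the left of the cycle, where it becomes a generator
  of the subgroup fixing \<open>1\<close>.
\<close>

lemma to_front_pi: 
  assumes "1 \<le> i" 
  shows "to_front (int i) \<circ> refl_pi i = to_front (int i + 1)" "to_front (int i + 1) \<circ> refl_pi i = to_front (int i)"
  using assms by (auto intro!: odd_map_ext odd_maps simp: refl_pi_pos to_front_pos)

lemma flip_ends_flip_ends: "flip_ends n (flip_ends n x) = x"
  by (auto simp: flip_ends_def)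

lemma to_front_hat:
  assumes "2 \<le> n" 
  shows "to_front (int n) \<circ> refl_hat n = flip_ends n \<circ> to_front (int n - 1)" 
    "to_front (int n - 1) \<circ> refl_hat n = flip_ends n \<circ> to_front (int n)"
  using assms by (auto intro!: odd_map_ext odd_maps simp: refl_hat_pos to_front_pos to_front_minus[of "int n"] to_front_minus[of "int n - 1"] flip_ends_pos simp del: minus_diff_eq)

lemma to_front_pi_fix: 
  assumes "1 \<le> i" "1 \<le> m" 
  shows "int i + 1 < m \<Longrightarrow> to_front m \<circ> refl_pi i = refl_pi (Suc i) \<circ> to_front m" 
    "m < int i \<Longrightarrow> to_front m \<circ> refl_pi i = refl_pi i \<circ> to_front m"
  using assms by (auto intro!: odd_map_ext odd_maps simp: refl_pi_pos to_front_pos)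

lemma to_front_hat_fix:
  assumes "2 \<le> n"  "1 \<le> m" "m < int n - 1" 
  shows "to_front m \<circ> refl_hat n = refl_hat n \<circ> to_front m"
  using assms by (auto intro!: odd_map_ext odd_maps simp: refl_hat_pos to_front_pos to_front_minus[of m] simp del: minus_diff_eq)

lemma flip_ends_pi:
  assumes "2 \<le> i" "i < n"
  shows "flip_ends n \<circ> refl_pi i = (if Suc i = n then refl_hat n else refl_pi i) \<circ> flip_ends n"
  using assms by (auto intro!: odd_map_ext odd_maps simp: refl_hat_pos refl_pi_pos flip_ends_pos refl_hat_minus[of "Suc i" "int i + 1"] refl_hat_minus[of "Suc i" 1] refl_pi_minus simp del: minus_add_distrib)

lemma flip_ends_hat:
  assumes "3 \<le> n" 
  shows "flip_ends n \<circ> refl_hat n = refl_pi (n - 1) \<circ> flip_ends n"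
  using assms by (auto intro!: odd_map_ext odd_maps simp: refl_hat_pos refl_pi_pos flip_ends_pos flip_ends_minus refl_pi_minus of_nat_diff simp del: minus_diff_eq)

lemma shift_refl_pi: "1 \<le> i \<Longrightarrow> shift_perm (refl_pi i) = refl_pi (Suc i)"
  by (auto simp: fun_eq_iff shift_perm_def refl_pi_val up_def down_def)

lemma shift_refl_hat: "2 \<le> m \<Longrightarrow> shift_perm (refl_hat m) = refl_hat (Suc m)"
  by (auto simp: fun_eq_iff shift_perm_def refl_hat_val up_def down_def)

lemma refl_pi_shift: "2 \<le> i \<Longrightarrow> i < Suc m \<Longrightarrow> refl_pi i \<in> shift_perm ` D_gens m"
  by (rule image_eqI[of _ _ "refl_pi (i - 1)"]) (auto simp: shift_refl_pi D_gens_def)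

lemma refl_hat_shift: "2 \<le> m \<Longrightarrow> refl_hat (Suc m) \<in> shift_perm ` D_gens m"
  by (rule image_eqI[of _ _ "refl_hat m"]) (auto simp: shift_refl_hat D_gens_def)

text \<open>
  Conjugation by the sign change at both ends exchanges the two generators that involve the last
  letter, which is the diagram automorphism of type D, and it fixes the other ones.
\<close>

lemma flip_ends_normalizes:
  assumes "r \<in> shift_perm ` D_gens m"
  shows "\<exists>r'\<in>shift_perm ` D_gens m. flip_ends (Suc m) \<circ> r = r' \<circ> flip_ends (Suc m)"
proof -
  from assms obtain s where s: "s \<in> D_gens m" "r = shift_perm s" by blast
  from s(1) show ?thesis
  proof (cases rule: D_gens_cases)
    case (1 i)
    then have "flip_ends (Suc m) \<circ> r = (if Suc i = m then refl_hat (Suc m) else refl_pi (Suc i)) \<circ> flip_ends (Suc m)"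
      using flip_ends_pi[of "Suc i" "Suc m"] s by (simp add: shift_refl_pi)
    moreover have "(if Suc i = m then refl_hat (Suc m) else refl_pi (Suc i)) \<in> shift_perm ` D_gens m"
      using 1 by (auto intro!: refl_pi_shift refl_hat_shift)
    ultimately show ?thesis by blast
  next
    case 2
    then have "flip_ends (Suc m) \<circ> r = refl_pi m \<circ> flip_ends (Suc m)"
      using flip_ends_hat[of "Suc m"] s by (simp add: shift_refl_hat)
    then show ?thesis using refl_pi_shift[of m m] 2 by auto
  qed
qed

text \<open>
  Together with \<open>coset_rep_fix\<close> this is Deodhar's lemma for the parabolic subgroup fixing \<open>1\<close>:
  multiplication of a representative by a generator either gives another representative or can
  be traded for a generator of the subgroup.
\<close>

lemma coset_rep_move:
  assumes n: "2 \<le> n" and k: "k \<in> coset_idx n" and s: "s \<in> D_gens n" and sk: "s k \<noteq> k"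
  shows "coset_rep n k \<circ> s = coset_rep n (s k)"
proof -
  have ff: "flip_ends n \<circ> (flip_ends n \<circ> f) = f" for f by (simp add: fun_eq_iff flip_ends_flip_ends)
  from s show ?thesis
  proof (cases rule: D_gens_cases)
    case (1 i)
    then have "\<bar>k\<bar> = int i \<or> \<bar>k\<bar> = int i + 1" using sk by (auto simp: refl_pi_val split: if_splits)
    then consider "k = int i" | "k = int i + 1" | "k = - int i" | "k = - (int i + 1)" by linarith
    then show ?thesis using 1
      by cases (simp_all add: coset_rep_def comp_assoc to_front_pi refl_pi_pos refl_pi_minus del: minus_add_distrib)
  next
    case 2
    then have "\<bar>k\<bar> = int n \<or> \<bar>k\<bar> = int n - 1" using sk by (auto simp: refl_hat_val split: if_splits)
    then consider "k = int n" | "k = int n - 1" | "k = - int n" | "k = - (int n - 1)" by linarith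
    then show ?thesis using 2
      by cases (simp_all add: coset_rep_def comp_assoc to_front_hat refl_hat_pos refl_hat_minus ff del: minus_diff_eq)
  qed
qed

lemma coset_len_move:
  assumes n: "2 \<le> n" and k: "k \<in> coset_idx n" and s: "s \<in> D_gens n"
  shows "s k \<in> coset_idx n" "coset_len n (s k) \<le> coset_len n k + 1"
proof -
  have "s \<in> hyperoctahedral n" using s by (rule D_gens_B)
  moreover have "k \<noteq> 0" "\<bar>k\<bar> \<le> int n" using n k by (auto simp: coset_idx_def)
  ultimately have "s k \<noteq> 0" "\<bar>s k\<bar> \<le> int n" by (rule B_range)+
  then show "s k \<in> coset_idx n" using n by (auto simp: coset_idx_def)
  show "coset_len n (s k) \<le> coset_len n k + 1"
    using s
  proof (cases rule: D_gens_cases)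
    case (1 i)
    then have "\<bar>k\<bar> = int i \<or> \<bar>k\<bar> = int i + 1 \<or> s k = k" by (auto simp: refl_pi_val split: if_splits)
    then consider "k = int i" | "k = int i + 1" | "k = - int i" | "k = - (int i + 1)" | "s k = k" by linarith
    then show ?thesis using 1 n
      by cases (simp_all add: coset_len_def refl_pi_pos refl_pi_minus del: minus_add_distrib)
  next
    case 2
    then have "\<bar>k\<bar> = int n \<or> \<bar>k\<bar> = int n - 1 \<or> s k = k" by (auto simp: refl_hat_val split: if_splits)
    then consider "k = int n" | "k = int n - 1" | "k = - int n" | "k = - (int n - 1)" | "s k = k" by linarith
    then show ?thesis using 2
      by cases (simp_all add: coset_len_def refl_hat_pos refl_hat_minus del: minus_diff_eq)
  qed
qed

lemma to_front_fix:
  assumes m: "1 \<le> m" and k: "0 < k" "k \<le> int (Suc m)" and s: "s \<in> D_gens (Suc m)" and sk: "s k = k"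
  shows "\<exists>r\<in>shift_perm ` D_gens m. to_front k \<circ> s = r \<circ> to_front k"
  using s
proof (cases rule: D_gens_cases)
  case (1 i)
  then have "k < int i \<or> int i + 1 < k" using k sk by (auto simp: refl_pi_pos split: if_splits)
  then show ?thesis
  proof
    assume "k < int i"
    then show ?thesis using 1 k to_front_pi_fix(2)[of i k] refl_pi_shift[of i m] by auto
  next
    assume "int i + 1 < k"
    then show ?thesis using 1 k to_front_pi_fix(1)[of i k] refl_pi_shift[of "Suc i" m] by auto
  qed
next
  case 2
  then have "k < int (Suc m) - 1" using k sk by (auto simp: refl_hat_pos split: if_splits)
  then show ?thesis using 2 k to_front_hat_fix[of "Suc m" k] refl_hat_shift[of m] by auto
qed

lemma coset_rep_fix:
  assumes m: "1 \<le> m" and k: "k \<in> coset_idx (Suc m)" and s: "s \<in> D_gens (Suc m)" and sk: "s k = k"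
  shows "\<exists>s'\<in>D_gens m. coset_rep (Suc m) k \<circ> s = shift_perm s' \<circ> coset_rep (Suc m) k"
proof (cases "k > 0")
  case True
  then show ?thesis using to_front_fix[OF m True _ s sk] k m by (auto simp: coset_rep_def coset_idx_def)
next
  case False
  then have nk: "0 < - k" "- k \<le> int (Suc m)" using k m by (auto simp: coset_idx_def)
  have "s (- k) = - k" using odd_map_gens[OF s] sk by (simp add: odd_map_def)
  from to_front_fix[OF m nk s this] obtain r where r: "r \<in> shift_perm ` D_gens m" "to_front (- k) \<circ> s = r \<circ> to_front (- k)" by blast
  from flip_ends_normalizes[OF r(1)] obtain r' where r': "r' \<in> shift_perm ` D_gens m" "flip_ends (Suc m) \<circ> r = r' \<circ> flip_ends (Suc m)" by blast
  have "coset_rep (Suc m) k \<circ> s = r' \<circ> coset_rep (Suc m) k"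
    using False by (simp add: coset_rep_def comp_assoc r(2)) (simp add: comp_assoc[symmetric] r'(2))
  then show ?thesis using r'(1) by blast
qed

lemma coset_rep_1: "coset_rep n 1 = id"
  by (auto simp: coset_rep_def to_front_def up_def fun_eq_iff)

lemma coset_rep_word:
  assumes n: "1 \<le> n" and k: "k \<in> coset_idx n"
  shows "\<exists>w. set w \<subseteq> D_gens n \<and> word_prod w = coset_rep n k \<and> length w = coset_len n k"
  using k
proof (induction "coset_len n k" arbitrary: k)
  case 0
  then have "k = 1" using n by (auto simp: coset_len_def coset_idx_def split: if_splits)
  then have "coset_rep n k = id" using coset_rep_1 by simp
  with 0 show ?case by (intro exI[of _ "[]"]) (simp only: word_prod_simps list.size list.set, simp)
next
  case (Suc l)
  then have n: "2 \<le> n" using n by (cases "n = 1") (auto simp: coset_idx_def coset_len_def)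
  \<comment> \<open>the generator that makes the representative shorter; the step from \<open>- n\<close> leads to \<open>n - 1\<close>\<close>
  define s where "s = (if k > 0 then refl_pi (nat k - 1) else if k = - int n then refl_hat n else refl_pi (nat (- k)))"
  have kr: "k \<noteq> 0" "\<bar>k\<bar> \<le> int n" "k \<noteq> 1"
    using Suc n by (auto simp: coset_idx_def coset_len_def split: if_splits)
  have s: "s \<in> D_gens n" using kr n by (auto simp: s_def D_gens_def intro!: exI)
  have sk: "s k = (if k > 0 then k - 1 else if k = - int n then int n - 1 else k - 1)"
    using kr n by (auto simp: s_def refl_pi_val refl_hat_val up_def down_def)
  then have "l = coset_len n (s k)" using kr n Suc(2) by (auto simp: coset_len_def)
  from Suc(1)[OF this] obtain w where w: "set w \<subseteq> D_gens n" "word_prod w = coset_rep n (s k)" "length w = coset_len n (s k)"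
    using coset_len_move[OF n Suc.prems s] by blast
  have ssk: "s (s k) = k" using D_gens_involution[OF s] by (auto simp: fun_eq_iff)
  have "s k \<noteq> k" using sk kr n by (auto split: if_splits)
  then have "s (s k) \<noteq> s k" unfolding ssk by simp
  then have "coset_rep n (s k) \<circ> s = coset_rep n (s (s k))"
    using coset_len_move[OF n Suc.prems s] by (intro coset_rep_move[OF n _ s])
  also note ssk
  finally have "word_prod (w @ [s]) = coset_rep n k" by (simp only: word_prod_append word_prod_simps comp_id w(2))
  then show ?case using w s \<open>l = coset_len n (s k)\<close> Suc(2) by (intro exI[of _ "w @ [s]"]) auto
qed

lemma coset_rep_in_D: "1 \<le> n \<Longrightarrow> k \<in> coset_idx n \<Longrightarrow> coset_rep n k \<in> coxeter_D n"
  using coset_rep_word[of n k] by (auto simp: coxeter_D_word)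

lemma shift_in_D: "\<tau> \<in> coxeter_D m \<Longrightarrow> shift_perm \<tau> \<in> coxeter_D (Suc m)"
  unfolding coxeter_D_word using shift_word shift_perm_gen by (metis image_subset_iff list.set_map subsetD)

text \<open>
  Reading a word from the left, each generator by Deodhar's lemma changes either the coset or the
  component in the subgroup, and in both cases the total length grows by at most one. This gives
  the existence of the factorisation and the hard inequality for the length at once.
\<close>

lemma factor_word:
  assumes m: "1 \<le> m" and w: "set w \<subseteq> D_gens (Suc m)"
  shows "\<exists>\<tau>\<in>coxeter_D m. \<exists>k\<in>coset_idx (Suc m). word_prod w = shift_perm \<tau> \<circ> coset_rep (Suc m) k \<and>
     D_length m \<tau> + coset_len (Suc m) k \<le> length w"
  using w
proof (induction w rule: rev_induct)
  case Nil
  have "coset_rep (Suc m) 1 = id" by (rule coset_rep_1)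
  then have "word_prod [] = shift_perm id \<circ> coset_rep (Suc m) 1"
    by (simp only: word_prod_simps shift_perm_id comp_id)
  moreover have "D_length m id + coset_len (Suc m) 1 \<le> length []"
    unfolding D_length_0 by (simp add: coset_len_def)
  moreover have "1 \<in> coset_idx (Suc m)" by (simp add: coset_idx_def)
  ultimately show ?case using D_id[of m] by blast
next
  case (snoc s w)
  then obtain \<tau> k where IH: "\<tau> \<in> coxeter_D m" "k \<in> coset_idx (Suc m)"
    "word_prod w = shift_perm \<tau> \<circ> coset_rep (Suc m) k" "D_length m \<tau> + coset_len (Suc m) k \<le> length w"
    by (metis le_sup_iff set_append)
  have s: "s \<in> D_gens (Suc m)" using snoc by simp
  have n: "2 \<le> Suc m" using m by simp
  show ?case
  proof (cases "s k = k")
    case True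
    from coset_rep_fix[OF m IH(2) s True] obtain s' where
      s': "s' \<in> D_gens m" "coset_rep (Suc m) k \<circ> s = shift_perm s' \<circ> coset_rep (Suc m) k" by blast
    have "shift_perm (\<tau> \<circ> s') = shift_perm \<tau> \<circ> shift_perm s'"
      using IH(1) s'(1) coxeter_D_subset_B D_gens_B by (intro shift_perm_comp)
    then have "word_prod (w @ [s]) = shift_perm (\<tau> \<circ> s') \<circ> coset_rep (Suc m) k"
      by (simp only: word_prod_append word_prod_simps comp_id IH(3) comp_assoc s'(2))
    moreover have "\<tau> \<circ> s' \<in> coxeter_D m" by (rule D_comp[OF IH(1) D_gen[OF s'(1)]])
    moreover have "D_length m (\<tau> \<circ> s') + coset_len (Suc m) k \<le> length (w @ [s])"
      using IH(4) D_length_comp_gen[OF IH(1) s'(1)] by simp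
    ultimately show ?thesis using IH(2) by blast
  next
    case False
    have "word_prod (w @ [s]) = shift_perm \<tau> \<circ> coset_rep (Suc m) (s k)"
      using coset_rep_move[OF n IH(2) s False]
      by (simp only: word_prod_append word_prod_simps comp_id IH(3) comp_assoc)
    moreover have "D_length m \<tau> + coset_len (Suc m) (s k) \<le> length (w @ [s])"
      using IH(4) coset_len_move(2)[OF n IH(2) s] by simp
    ultimately show ?thesis using IH(1) coset_len_move(1)[OF n IH(2) s] by blast
  qed
qed

lemma factor_exists:
  assumes \<sigma>: "\<sigma> \<in> coxeter_D (Suc m)"
  shows "\<exists>\<tau>\<in>coxeter_D m. \<exists>k\<in>coset_idx (Suc m). \<sigma> = shift_perm \<tau> \<circ> coset_rep (Suc m) k \<and>
     D_length m \<tau> + coset_len (Suc m) k \<le> D_length (Suc m) \<sigma>"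
proof (cases "m = 0")
  case True
  then have "\<sigma> = id" using \<sigma> coxeter_D_trivial[of 1] by simp
  then have "\<sigma> = shift_perm id \<circ> coset_rep (Suc m) 1" by (simp only: coset_rep_1 shift_perm_id comp_id)
  moreover have "D_length m id + coset_len (Suc m) 1 \<le> D_length (Suc m) \<sigma>" unfolding D_length_0 by (simp add: coset_len_def)
  moreover have "1 \<in> coset_idx (Suc m)" by (simp add: coset_idx_def)
  ultimately show ?thesis using D_id[of m] by blast
next
  case False
  from \<sigma> obtain w where "set w \<subseteq> D_gens (Suc m)" "word_prod w = \<sigma>" "length w = D_length (Suc m) \<sigma>"
    by (rule D_length_word)
  then show ?thesis using factor_word[of m w] False by simp
qed

lemma D_length_factor_le:
  assumes \<tau>: "\<tau> \<in> coxeter_D m" and k: "k \<in> coset_idx (Suc m)"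
  shows "D_length (Suc m) (shift_perm \<tau> \<circ> coset_rep (Suc m) k) \<le> D_length m \<tau> + coset_len (Suc m) k"
proof -
  from \<tau> obtain v where v: "set v \<subseteq> D_gens m" "word_prod v = \<tau>" "length v = D_length m \<tau>"
    by (rule D_length_word)
  from coset_rep_word[OF _ k] obtain w where w: "set w \<subseteq> D_gens (Suc m)"
    "word_prod w = coset_rep (Suc m) k" "length w = coset_len (Suc m) k" by auto
  have "word_prod (map shift_perm v @ w) = shift_perm \<tau> \<circ> coset_rep (Suc m) k"
    using shift_word[OF v(1)] v w by (simp only: word_prod_append)
  moreover have "set (map shift_perm v @ w) \<subseteq> D_gens (Suc m)"
    using v w shift_perm_gen by auto
  ultimately show ?thesis using D_length_le[of "map shift_perm v @ w" "Suc m"] v w by simp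
qed

lemma coset_rep_1_iff:
  assumes "k \<in> coset_idx (Suc m)" shows "coset_rep (Suc m) k j = 1 \<longleftrightarrow> j = k"
proof -
  have b: "bij (coset_rep (Suc m) k)" using coset_rep_in_D[OF _ assms] by (intro coxeter_D_bij) auto
  have "coset_rep (Suc m) k k = 1" using assms by (auto simp: coset_rep_def to_front_def flip_ends_def coset_idx_def split: if_splits)
  then show ?thesis using bij_is_inj[OF b] by (metis injD)
qed

lemma shift_perm_1_iff:
  assumes "\<tau> \<in> coxeter_D m" shows "shift_perm \<tau> j = 1 \<longleftrightarrow> j = 1"
proof -
  have b: "bij (shift_perm \<tau>)" using shift_in_D[OF assms] by (rule coxeter_D_bij)
  have "shift_perm \<tau> 1 = 1" by (simp add: shift_perm_def)
  then show ?thesis using bij_is_inj[OF b] by (metis injD)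
qed

lemma factor_unique:
  assumes "\<tau> \<in> coxeter_D m" "\<tau>' \<in> coxeter_D m" "k \<in> coset_idx (Suc m)" "k' \<in> coset_idx (Suc m)"
    and e: "shift_perm \<tau> \<circ> coset_rep (Suc m) k = shift_perm \<tau>' \<circ> coset_rep (Suc m) k'"
  shows "\<tau> = \<tau>' \<and> k = k'"
proof -
  have "(shift_perm \<tau> \<circ> coset_rep (Suc m) k) k = 1"
    using assms(1,3) by (simp add: coset_rep_1_iff shift_perm_1_iff)
  then have "(shift_perm \<tau>' \<circ> coset_rep (Suc m) k') k = 1" using e by metis
  then have kk: "k = k'" using assms(2,4) by (simp add: coset_rep_1_iff shift_perm_1_iff)
  have "bij (coset_rep (Suc m) k)" using coset_rep_in_D[OF _ assms(3)] by (intro coxeter_D_bij) auto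
  then have "surj (coset_rep (Suc m) k)" by (rule bij_is_surj)
  then have "shift_perm \<tau> = shift_perm \<tau>'" using e kk by (metis fun.inj_map_strong surj_fun_eq comp_apply)
  then show ?thesis using kk shift_perm_eqD assms coxeter_D_subset_B by blast
qed

lemma D_length_factor:
  assumes \<tau>: "\<tau> \<in> coxeter_D m" and k: "k \<in> coset_idx (Suc m)"
  shows "D_length (Suc m) (shift_perm \<tau> \<circ> coset_rep (Suc m) k) = D_length m \<tau> + coset_len (Suc m) k"
proof -
  have "shift_perm \<tau> \<circ> coset_rep (Suc m) k \<in> coxeter_D (Suc m)"
    using \<tau> k by (intro D_comp shift_in_D coset_rep_in_D) auto
  from factor_exists[OF this] show ?thesis
    using factor_unique[OF \<tau> _ k] D_length_factor_le[OF \<tau> k] by (metis le_antisym)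
qed

lemma sum_coxeter_D_factor:
  fixes F :: "nat \<Rightarrow> (int \<Rightarrow> int) \<Rightarrow> 'a::comm_monoid_add"
  shows "(\<Sum>\<sigma>\<in>coxeter_D (Suc m). F (D_length (Suc m) \<sigma>) \<sigma>) =
    (\<Sum>\<tau>\<in>coxeter_D m. \<Sum>k\<in>coset_idx (Suc m).
       F (D_length m \<tau> + coset_len (Suc m) k) (shift_perm \<tau> \<circ> coset_rep (Suc m) k))"
proof -
  let ?g = "\<lambda>(\<tau>, k). shift_perm \<tau> \<circ> coset_rep (Suc m) k"
  have "bij_betw ?g (coxeter_D m \<times> coset_idx (Suc m)) (coxeter_D (Suc m))"
    unfolding bij_betw_def
  proof
    show "inj_on ?g (coxeter_D m \<times> coset_idx (Suc m))"
      using factor_unique by (fastforce simp: inj_on_def)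
    show "?g ` (coxeter_D m \<times> coset_idx (Suc m)) = coxeter_D (Suc m)"
    proof
      show "?g ` (coxeter_D m \<times> coset_idx (Suc m)) \<subseteq> coxeter_D (Suc m)"
        using D_comp shift_in_D coset_rep_in_D[of "Suc m"] by force
      show "coxeter_D (Suc m) \<subseteq> ?g ` (coxeter_D m \<times> coset_idx (Suc m))"
        using factor_exists by force
    qed
  qed
  from sum.reindex_bij_betw[OF this, of "\<lambda>\<sigma>. F (D_length (Suc m) \<sigma>) \<sigma>", symmetric]
  have "(\<Sum>\<sigma>\<in>coxeter_D (Suc m). F (D_length (Suc m) \<sigma>) \<sigma>) = (\<Sum>p\<in>coxeter_D m \<times> coset_idx (Suc m).
      F (D_length m (fst p) + coset_len (Suc m) (snd p)) (shift_perm (fst p) \<circ> coset_rep (Suc m) (snd p)))"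
    by (rule trans) (auto intro!: sum.cong simp: D_length_factor)
  then show ?thesis by (simp add: sum.cartesian_product case_prod_unfold)
qed

section \<open>The annihilation operator as a sum over cosets\<close>

text \<open>
  Creation and annihilation are defined here for all functionals on tuples and not only for
  elements of the Fock space, so that they are linear without any side condition. Evaluating a
  tensor at the image of a tuple under \<open>inv \<sigma>\<close> amounts to letting \<open>\<sigma>\<close> act on the tensor.
\<close>

definition create :: "'h::complex_hilbert \<Rightarrow> 'h tensor \<Rightarrow> 'h tensor" where
  "create x f zs = (case zs of [] \<Rightarrow> 0 | z # zs' \<Rightarrow> cinner z x * f zs')"

definition annih :: "('h \<Rightarrow> 'h) \<Rightarrow> real \<Rightarrow> 'h \<Rightarrow> 'h::complex_hilbert tensor \<Rightarrow> 'h tensor" where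
  "annih J q x f zs = (\<Sum>k\<in>coset_idx (Suc (length zs)).
     complex_of_real (q ^ coset_len (Suc (length zs)) k) *
     f (sact J (inv (coset_rep (Suc (length zs)) k)) (x # zs)))"

definition symmetrizer :: "('h \<Rightarrow> 'h) \<Rightarrow> real \<Rightarrow> 'h::complex_hilbert tensor \<Rightarrow> 'h tensor" where
  "symmetrizer J q f zs = (\<Sum>\<sigma>\<in>coxeter_D (length zs).
     complex_of_real (q ^ D_length (length zs) \<sigma>) * f (sact J (inv \<sigma>) zs))"

lemma combo_Nil [simp]: "combo \<phi> [] = (\<lambda>_. 0)"
  by (simp add: combo_def)

lemma combo_Cons [simp]: "combo \<phi> ((c, xs) # w) = (\<lambda>zs. c * \<phi> xs zs + combo \<phi> w zs)"
  by (simp add: combo_def)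

lemma combo_append: "combo \<phi> (v @ w) = (\<lambda>zs. combo \<phi> v zs + combo \<phi> w zs)"
  by (simp add: combo_def)

lemma combo_scale: "combo \<phi> (map (\<lambda>(c, xs). (a * c, xs)) w) = (\<lambda>zs. a * combo \<phi> w zs)"
  by (induction w) (auto simp: algebra_simps)

lemma Fock_combo: "combo etens w \<in> Fock"
  by (simp add: Fock_def)

lemma FockE:
  assumes "f \<in> Fock" obtains w where "f = combo etens w"
  using assms by (auto simp: Fock_def)

lemma Fock_add: "f \<in> Fock \<Longrightarrow> g \<in> Fock \<Longrightarrow> (\<lambda>zs. f zs + g zs) \<in> Fock"
  by (elim FockE) (simp only: combo_append[symmetric] Fock_combo)

lemma Fock_scale: "f \<in> Fock \<Longrightarrow> (\<lambda>zs. a * f zs) \<in> Fock"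
  by (elim FockE) (simp only: combo_scale[symmetric] Fock_combo)

lemma Fock_0: "(\<lambda>_. 0) \<in> Fock"
  using Fock_combo[of "[]"] by simp

lemma Fock_etens: "etens xs \<in> Fock"
proof -
  have "etens xs = combo etens [(1, xs)]" by simp
  then show ?thesis by (simp only: Fock_combo)
qed

lemma Fock_sum: "(\<And>i. i \<in> A \<Longrightarrow> f i \<in> Fock) \<Longrightarrow> (\<lambda>zs. \<Sum>i\<in>A. f i zs) \<in> Fock"
proof (induction A rule: infinite_finite_induct)
  case (insert i A)
  then show ?case using Fock_add[of "f i" "\<lambda>zs. \<Sum>i\<in>A. f i zs"] by simp
qed (simp_all add: Fock_0)

lemma Fock_induct [consumes 1, case_names zero add]:
  assumes "f \<in> Fock" "P (\<lambda>_. 0)" "\<And>c xs f. f \<in> Fock \<Longrightarrow> P f \<Longrightarrow> P (\<lambda>zs. c * etens xs zs + f zs)"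
  shows "P f"
proof -
  from assms(1) obtain w where f: "f = combo etens w" by (rule FockE)
  have "P (combo etens w)"
  proof (induction w)
    case (Cons a w)
    then show ?case using assms(3)[of "combo etens w" "fst a" "snd a"] by (cases a) (simp add: Fock_combo)
  qed (simp add: assms(2))
  then show ?thesis using f by simp
qed

lemma etens_Cons: "etens ys (z # zs) = (case ys of [] \<Rightarrow> 0 | y # ys' \<Rightarrow> cinner z y * etens ys' zs)"
  by (auto simp: etens_def tuple_inner_def prod.lessThan_Suc_shift simp del: prod.lessThan_Suc split: list.splits)

lemma etens_length: "length xs \<noteq> length zs \<Longrightarrow> etens xs zs = 0"
  by (simp add: etens_def tuple_inner_def)

lemma etens_Nil: "etens [] [] = 1"
  by (simp add: etens_def tuple_inner_def)

lemma create_etens: "create x (etens xs) = etens (x # xs)"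
  by (auto simp: create_def fun_eq_iff etens_Cons etens_length split: list.splits)

lemma create_lin: "create x (\<lambda>zs. a * f zs + b * g zs) = (\<lambda>zs. a * create x f zs + b * create x g zs)"
  by (auto simp: create_def fun_eq_iff algebra_simps split: list.splits)

lemma annih_lin: "annih J q x (\<lambda>zs. a * f zs + b * g zs) = (\<lambda>zs. a * annih J q x f zs + b * annih J q x g zs)"
  by (auto simp: annih_def fun_eq_iff algebra_simps sum.distrib sum_distrib_left)

lemma symmetrizer_lin: "symmetrizer J q (\<lambda>zs. a * f zs + b * g zs) = (\<lambda>zs. a * symmetrizer J q f zs + b * symmetrizer J q g zs)"
  by (auto simp: symmetrizer_def fun_eq_iff algebra_simps sum.distrib sum_distrib_left)

lemma symmetrizer_0: "symmetrizer J q (\<lambda>_. 0) = (\<lambda>_. 0)"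
  by (simp add: symmetrizer_def fun_eq_iff)

lemma Fock_closed_linear:
  assumes "\<And>a b f g. T (\<lambda>zs. a * f zs + b * g zs) = (\<lambda>zs. a * T f zs + b * T g zs)"
    and "\<And>xs. T (etens xs) \<in> Fock" and "f \<in> Fock"
  shows "T f \<in> Fock"
  using assms(3)
proof (induction rule: Fock_induct)
  case zero
  have "T (\<lambda>_. 0) = (\<lambda>_. 0)" using assms(1)[of 0 undefined 0 undefined] by simp
  then show ?case by (simp add: Fock_0)
next
  case (add c xs f)
  then show ?case using assms(1)[of c "etens xs" 1 f] assms(2)[of xs]
    by (simp add: Fock_add Fock_scale)
qed

lemma create_Fock: "f \<in> Fock \<Longrightarrow> create x f \<in> Fock"
  by (rule Fock_closed_linear) (simp_all add: create_lin create_etens Fock_etens)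

lemma creation_Fock:
  assumes "f \<in> Fock" shows "creation x f = create x f"
proof -
  from assms obtain w where f: "f = combo etens w" by (rule FockE)
  have "combo (\<lambda>xs. etens (x # xs)) w = create x (combo etens w)"
  proof (induction w)
    case Nil
    then show ?case by (auto simp: create_def fun_eq_iff split: list.splits)
  next
    case (Cons a w)
    then show ?case using create_lin[of x "fst a" "etens (snd a)" 1 "combo etens w"]
      by (cases a) (simp add: create_etens)
  qed
  then show ?thesis by (simp add: f creation_combo)
qed

lemma symmetrizer_etens:
  assumes J: "selfadjoint_involution J"
  shows "symmetrizer J q (etens xs) = (\<lambda>zs. \<Sum>\<sigma>\<in>coxeter_D (length xs).
      complex_of_real (q ^ D_length (length xs) \<sigma>) * etens (sact J \<sigma> xs) zs)"
proof
  fix zs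
  show "symmetrizer J q (etens xs) zs = (\<Sum>\<sigma>\<in>coxeter_D (length xs).
      complex_of_real (q ^ D_length (length xs) \<sigma>) * etens (sact J \<sigma> xs) zs)"
  proof (cases "length zs = length xs")
    case True
    then show ?thesis
      by (auto simp: symmetrizer_def intro!: sum.cong etens_sact[OF J, symmetric] coxeter_D_subset_B)
  qed (simp add: symmetrizer_def etens_length)
qed

lemma symmetrizer_Fock:
  assumes J: "selfadjoint_involution J" and f: "f \<in> Fock"
  shows "symmetrizer J q f \<in> Fock"
  using f by (rule Fock_closed_linear[rotated 2]) (auto simp: symmetrizer_lin symmetrizer_etens[OF J] intro!: Fock_sum Fock_scale Fock_etens)

lemma Phat_Fock:
  assumes J: "selfadjoint_involution J" and f: "f \<in> Fock"
  shows "Phat J q f = symmetrizer J q f"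
proof -
  from f obtain w where f: "f = combo etens w" by (rule FockE)
  have "combo (\<lambda>xs. symmetrizer J q (etens xs)) w = symmetrizer J q (combo etens w)"
  proof (induction w)
    case Nil
    then show ?case by (simp add: symmetrizer_0)
  next
    case (Cons a w)
    then show ?case using symmetrizer_lin[of J q "fst a" "etens (snd a)" 1 "combo etens w"]
      by (cases a) simp
  qed
  then show ?thesis by (simp add: f Phat_combo[OF J] symmetrizer_etens[OF J])
qed

lemma fock_inner0_combo_left:
  assumes "g \<in> Fock"
  shows "fock_inner0 (combo etens v) g = (\<Sum>(c, xs)\<leftarrow>v. cnj c * g xs)"
proof -
  from assms obtain w where g: "g = combo etens w" by (rule FockE)
  have "(\<Sum>(d, ys)\<leftarrow>w. c * d * tuple_inner xs ys) = c * combo etens w xs" for c xs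
    by (induction w) (auto simp: algebra_simps etens_def)
  then show ?thesis unfolding g fock_inner0_combo by simp
qed

lemma fock_inner_combo:
  assumes J: "selfadjoint_involution J" and g: "g \<in> Fock"
  shows "fock_inner J q (combo etens v) g = (\<Sum>(c, xs)\<leftarrow>v. cnj c * symmetrizer J q g xs)"
  by (simp add: fock_inner_def Phat_Fock[OF J g] fock_inner0_combo_left[OF symmetrizer_Fock[OF J g]])

lemma fock_inner_etens:
  assumes "selfadjoint_involution J" "g \<in> Fock"
  shows "fock_inner J q (etens xs) g = symmetrizer J q g xs"
  using fock_inner_combo[OF assms, of q "[(1, xs)]"] by simp

lemma fock_inner_lin_left:
  assumes J: "selfadjoint_involution J" and g: "g \<in> Fock" and f: "f \<in> Fock"
  shows "fock_inner J q (\<lambda>zs. c * etens xs zs + f zs) g = cnj c * symmetrizer J q g xs + fock_inner J q f g"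
proof -
  from f obtain w where f: "f = combo etens w" by (rule FockE)
  show ?thesis using fock_inner_combo[OF J g, of q "(c, xs) # w"] fock_inner_combo[OF J g, of q w]
    by (simp add: f)
qed

lemma fock_inner_0_left:
  assumes J: "selfadjoint_involution J" and g: "g \<in> Fock"
  shows "fock_inner J q (\<lambda>_. 0) g = 0"
  using fock_inner_combo[OF J g, of q "[]"] by simp

lemma fock_inner_lin_right:
  assumes J: "selfadjoint_involution J" and h: "h \<in> Fock" and f: "f \<in> Fock" and g: "g \<in> Fock"
  shows "fock_inner J q h (\<lambda>zs. a * f zs + b * g zs) = a * fock_inner J q h f + b * fock_inner J q h g"
  using h
proof (induction rule: Fock_induct)
  case zero
  then show ?case using f g by (simp add: fock_inner_0_left[OF J] Fock_add Fock_scale)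
next
  case (add c xs h)
  then show ?case using f g by (simp add: fock_inner_lin_left[OF J] Fock_add Fock_scale symmetrizer_lin)
      (simp add: algebra_simps)
qed

text \<open>
  The symmetrization operator is selfadjoint because inversion preserves \<open>D(n)\<close> and the length.
\<close>

lemma symmetrizer_etens_commute:
  assumes J: "selfadjoint_involution J"
  shows "symmetrizer J q (etens ys) xs = cnj (symmetrizer J q (etens xs) ys)"
proof (cases "length xs = length ys")
  case True
  have "symmetrizer J q (etens ys) xs = (\<Sum>\<sigma>\<in>coxeter_D (length xs).
      complex_of_real (q ^ D_length (length xs) \<sigma>) * etens ys (sact J \<sigma> xs))"
    unfolding symmetrizer_def
    by (rule sum.reindex_bij_witness[of _ inv inv])
      (auto simp: inv_inv_eq coxeter_D_bij coxeter_D.D_inv D_length_inv)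
  also have "\<dots> = (\<Sum>\<sigma>\<in>coxeter_D (length xs).
      complex_of_real (q ^ D_length (length xs) \<sigma>) * cnj (etens (sact J \<sigma> xs) ys))"
    unfolding etens_def by (subst (2) tuple_inner_commute) simp
  also have "\<dots> = cnj (symmetrizer J q (etens xs) ys)"
    using True by (simp add: symmetrizer_etens[OF J])
  finally show ?thesis .
qed (simp add: symmetrizer_def etens_length)

lemma fock_inner_commute:
  assumes J: "selfadjoint_involution J" and f: "f \<in> Fock" and g: "g \<in> Fock"
  shows "fock_inner J q f g = cnj (fock_inner J q g f)"
proof -
  have e: "symmetrizer J q f xs = cnj (fock_inner J q f (etens xs))" for xs
    using f
  proof (induction rule: Fock_induct)
    case zero
    then show ?case by (simp add: symmetrizer_0 fock_inner_0_left[OF J] Fock_etens)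
  next
    case (add c ys f)
    then show ?case using symmetrizer_lin[of J q c "etens ys" 1 f]
      by (simp add: fock_inner_lin_left[OF J] Fock_etens symmetrizer_etens_commute[OF J, of q ys xs])
  qed
  show ?thesis
    using g
  proof (induction rule: Fock_induct)
    case zero
    show ?case using fock_inner_lin_right[OF J f Fock_0 Fock_0, of q 0 0]
      by (simp add: fock_inner_0_left[OF J f])
  next
    case (add c ys g)
    then show ?case using fock_inner_lin_right[OF J f Fock_etens add(1), of q c ys 1]
      by (simp add: fock_inner_lin_left[OF J f] e)
  qed
qed

lemma inv_shift_perm:
  assumes "\<tau> \<in> coxeter_D m"
  shows "inv (shift_perm \<tau>) = shift_perm (inv \<tau>)"
proof -
  have B: "\<tau> \<in> hyperoctahedral m" "inv \<tau> \<in> hyperoctahedral m"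
    using assms coxeter_D_subset_B B_inv by blast+
  have b: "bij \<tau>" using assms by (rule coxeter_D_bij)
  have "\<tau> \<circ> inv \<tau> = id" "inv \<tau> \<circ> \<tau> = id"
    using b bij_is_surj surj_iff bij_is_inj inj_iff by metis+
  then show ?thesis
    using shift_perm_comp[OF B] shift_perm_comp[OF B(2,1)] by (intro inv_unique_comp) (metis shift_perm_id)+
qed

lemma signed_nth_Cons_up: "k \<noteq> 0 \<Longrightarrow> signed_nth J (x # xs) (up k) = signed_nth J xs k"
proof -
  assume "k \<noteq> 0"
  then consider "k > 0" | "k < 0" by linarith
  then show ?thesis
  proof cases
    case 1
    then have "nat (k + 1) - 1 = Suc (nat k - 1)" by simp
    then show ?thesis using 1 unfolding signed_nth_def up_def by simp
  next
    case 2
    then have "nat (- (k - 1)) - 1 = Suc (nat (- k) - 1)" by simp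
    then show ?thesis using 2 unfolding signed_nth_def up_def by simp
  qed
qed

lemma sact_shift_perm:
  assumes "\<tau> \<in> coxeter_D (length xs)"
  shows "sact J (shift_perm \<tau>) (x # xs) = x # sact J \<tau> xs"
proof (rule nth_equalityI)
  fix i assume i: "i < length (sact J (shift_perm \<tau>) (x # xs))"
  show "sact J (shift_perm \<tau>) (x # xs) ! i = (x # sact J \<tau> xs) ! i"
  proof (cases i)
    case 0
    then show ?thesis unfolding sact_def inv_shift_perm[OF assms]
      by (simp add: shift_perm_def signed_nth_def nth_append del: upt_Suc)
  next
    case (Suc l)
    have "inv \<tau> \<in> hyperoctahedral (length xs)" using assms coxeter_D_subset_B B_inv by blast
    then have nz: "inv \<tau> (int l + 1) \<noteq> 0" using hyperoctahedral_0 by fastforce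
    have "down (int (Suc l) + 1) = int l + 1" by (simp add: down_def)
    then have "shift_perm (inv \<tau>) (int (Suc l) + 1) = up (inv \<tau> (int l + 1))"
      by (simp add: shift_perm_def)
    then have "sact J (shift_perm \<tau>) (x # xs) ! i = signed_nth J (x # xs) (up (inv \<tau> (int l + 1)))"
      using i Suc unfolding sact_def inv_shift_perm[OF assms] by (simp del: upt_Suc of_nat_Suc)
    then show ?thesis using i Suc by (simp add: signed_nth_Cons_up[OF nz]) (simp add: sact_def)
  qed
qed simp

definition delete_nth :: "nat \<Rightarrow> 'a list \<Rightarrow> 'a list" where
  "delete_nth i xs = take i xs @ drop (Suc i) xs"

definition apply_last :: "('a \<Rightarrow> 'a) \<Rightarrow> 'a list \<Rightarrow> 'a list" where
  "apply_last J xs = xs[length xs - 1 := J (xs ! (length xs - 1))]"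

lemma length_delete_nth [simp]: "i < length xs \<Longrightarrow> length (delete_nth i xs) = length xs - 1"
  by (simp add: delete_nth_def)

lemma length_apply_last [simp]: "length (apply_last J xs) = length xs"
  by (simp add: apply_last_def)

lemma nth_delete_nth: "i < length xs \<Longrightarrow> j < length xs - 1 \<Longrightarrow> delete_nth i xs ! j = xs ! (if j < i then j else Suc j)"
  by (auto simp: delete_nth_def nth_append)

lemma inv_coset_rep:
  assumes "1 \<le> n" "k \<in> coset_idx n" "coset_rep n k i = j"
  shows "inv (coset_rep n k) j = i"
  using coset_rep_in_D[OF assms(1,2)] coxeter_D_bij bij_is_inj assms(3) by (metis inv_f_f)

text \<open>
  The two kinds of representatives move the chosen vector to the front; the negative ones apply
  the involution to it and to the last of the remaining vectors.
\<close>

lemma sact_coset_rep_pos: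
  assumes i: "i < length ys"
  shows "sact J (coset_rep (length ys) (int i + 1)) ys = ys ! i # delete_nth i ys"
proof (rule nth_equalityI)
  let ?n = "length ys"
  fix j assume "j < length (sact J (coset_rep ?n (int i + 1)) ys)"
  then have j: "j < ?n" by simp
  have K: "int i + 1 \<in> coset_idx ?n" "1 \<le> ?n" using i by (auto simp: coset_idx_def)
  define l where "l = (if j = 0 then i else if j \<le> i then j - 1 else j)"
  have "coset_rep ?n (int i + 1) (int l + 1) = int j + 1"
    unfolding coset_rep_def using j by (auto simp: to_front_pos l_def)
  then have "inv (coset_rep ?n (int i + 1)) (int j + 1) = int l + 1" by (rule inv_coset_rep[OF K(2,1)])
  then have "sact J (coset_rep ?n (int i + 1)) ys ! j = ys ! l" using j by (simp add: sact_def signed_nth_def nat_add_distrib)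
  also have "ys ! l = (ys ! i # delete_nth i ys) ! j" using i j
    by (cases j) (auto simp: l_def nth_delete_nth)
  finally show "sact J (coset_rep ?n (int i + 1)) ys ! j = (ys ! i # delete_nth i ys) ! j" .
qed (use i in auto)

lemma sact_flip_ends:
  assumes n: "2 \<le> length zs"
  shows "sact J (flip_ends (length zs)) zs = J (hd zs) # apply_last J (tl zs)"
proof (rule nth_equalityI)
  let ?n = "length zs"
  fix j assume "j < length (sact J (flip_ends ?n) zs)"
  then have j: "j < ?n" by simp
  have "inv (flip_ends ?n) = flip_ends ?n"
    by (rule inv_unique_comp) (auto simp: fun_eq_iff flip_ends_flip_ends)
  then have s: "sact J (flip_ends ?n) zs ! j = signed_nth J zs (flip_ends ?n (int j + 1))"
    using j by (simp add: sact_def)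
  have "sact J (flip_ends ?n) zs ! j = (if j = 0 \<or> j = ?n - 1 then J (zs ! j) else zs ! j)"
    unfolding s using j n by (auto simp: flip_ends_pos signed_nth_def nat_add_distrib)
  also have "\<dots> = (J (hd zs) # apply_last J (tl zs)) ! j"
    using j n by (cases zs; cases j) (auto simp: apply_last_def nth_list_update nth_Cons')
  finally show "sact J (flip_ends ?n) zs ! j = (J (hd zs) # apply_last J (tl zs)) ! j" .
qed (use n in auto)

lemma sact_coset_rep_neg:
  assumes J: "selfadjoint_involution J" and n: "2 \<le> length ys" and i: "i < length ys"
  shows "sact J (coset_rep (length ys) (- (int i + 1))) ys = J (ys ! i) # apply_last J (delete_nth i ys)"
proof -
  let ?n = "length ys"
  have JJ: "\<And>x. J (J x) = x" using J by (simp add: selfadjoint_involution_def)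
  have "coset_rep ?n (- 1) = flip_ends ?n" using coset_rep_1[of ?n] by (auto simp: coset_rep_def)
  moreover have "- 1 \<in> coset_idx ?n" "int i + 1 \<in> coset_idx ?n" using n i by (auto simp: coset_idx_def)
  ultimately have B: "flip_ends ?n \<in> hyperoctahedral ?n" "coset_rep ?n (int i + 1) \<in> hyperoctahedral ?n"
    using coset_rep_in_D coxeter_D_subset_B n by (metis Suc_leD numeral_2_eq_2 One_nat_def)+
  have "coset_rep ?n (- (int i + 1)) = flip_ends ?n \<circ> coset_rep ?n (int i + 1)"
    by (simp add: coset_rep_def add.commute)
  then have "sact J (coset_rep ?n (- (int i + 1))) ys = sact J (flip_ends ?n) (ys ! i # delete_nth i ys)"
    using sact_comp[of J "flip_ends ?n" ys "coset_rep ?n (int i + 1)", OF JJ B] sact_coset_rep_pos[OF i] by simp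
  moreover have "length (ys ! i # delete_nth i ys) = ?n" using i n by simp
  ultimately show ?thesis using sact_flip_ends[of "ys ! i # delete_nth i ys" J] n by (metis list.sel(1,3))
qed

lemma annih_etens_Nil: "annih J q x (etens []) = (\<lambda>_. 0)"
  by (simp add: annih_def fun_eq_iff etens_length)

lemma annih_etens_coset:
  assumes J: "selfadjoint_involution J" and ys: "length ys = Suc m"
  shows "annih J q x (etens ys) = (\<lambda>zs. \<Sum>k\<in>coset_idx (Suc m).
     complex_of_real (q ^ coset_len (Suc m) k) * cinner x (hd (sact J (coset_rep (Suc m) k) ys)) *
       etens (tl (sact J (coset_rep (Suc m) k) ys)) zs)"
proof
  fix zs
  show "annih J q x (etens ys) zs = (\<Sum>k\<in>coset_idx (Suc m).
     complex_of_real (q ^ coset_len (Suc m) k) * cinner x (hd (sact J (coset_rep (Suc m) k) ys)) *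
       etens (tl (sact J (coset_rep (Suc m) k) ys)) zs)"
  proof (cases "length zs = m")
    case True
    have "etens ys (sact J (inv (coset_rep (Suc m) k)) (x # zs)) =
        cinner x (hd (sact J (coset_rep (Suc m) k) ys)) * etens (tl (sact J (coset_rep (Suc m) k) ys)) zs"
      if "k \<in> coset_idx (Suc m)" for k
    proof -
      have "coset_rep (Suc m) k \<in> hyperoctahedral (length ys)"
        using coset_rep_in_D[OF _ that] coxeter_D_subset_B ys by simp
      from etens_sact[OF J this, of "x # zs", symmetric] show ?thesis
        using ys by (cases "sact J (coset_rep (Suc m) k) ys") (auto simp: etens_Cons dest: arg_cong[of _ _ length])
    qed
    then show ?thesis using True by (simp add: annih_def mult.assoc)
  next
    case False
    then show ?thesis using ys by (simp add: annih_def etens_length)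
  qed
qed

lemma annih_Fock:
  assumes J: "selfadjoint_involution J" and f: "f \<in> Fock"
  shows "annih J q x f \<in> Fock"
proof (rule Fock_closed_linear[OF annih_lin _ f])
  fix ys :: "'a list"
  show "annih J q x (etens ys) \<in> Fock"
  proof (cases ys)
    case Nil
    then show ?thesis by (simp add: annih_etens_Nil Fock_0)
  next
    case (Cons y ys')
    then show ?thesis using annih_etens_coset[OF J, of ys "length ys'"]
      by (auto intro!: Fock_sum Fock_scale Fock_etens)
  qed
qed

text \<open>
  This is the factorisation of the symmetrization operator in degree \<open>n + 1\<close> through that of degree
  \<open>n\<close>, evaluated at a tuple with first entry \<open>x\<close>. It says that \<^const>\<open>annih\<close> is adjoint to
  \<^const>\<open>create\<close>.
\<close>

lemma symmetrizer_Cons: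
  assumes J: "selfadjoint_involution J"
  shows "symmetrizer J q g (x # xs) = symmetrizer J q (annih J q x g) xs"
proof -
  let ?m = "length xs"
  have JJ: "\<And>x. J (J x) = x" using J by (simp add: selfadjoint_involution_def)
  have s: "sact J (inv (shift_perm \<tau> \<circ> coset_rep (Suc ?m) k)) (x # xs) =
      sact J (inv (coset_rep (Suc ?m) k)) (x # sact J (inv \<tau>) xs)"
    if \<tau>: "\<tau> \<in> coxeter_D ?m" and k: "k \<in> coset_idx (Suc ?m)" for \<tau> k
  proof -
    have c: "coset_rep (Suc ?m) k \<in> coxeter_D (Suc ?m)" using coset_rep_in_D[OF _ k] by simp
    have "inv (shift_perm \<tau> \<circ> coset_rep (Suc ?m) k) = inv (coset_rep (Suc ?m) k) \<circ> shift_perm (inv \<tau>)"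
      using o_inv_distrib[OF coxeter_D_bij[OF shift_in_D[OF \<tau>]] coxeter_D_bij[OF c]] inv_shift_perm[OF \<tau>] by metis
    moreover have "inv (coset_rep (Suc ?m) k) \<in> hyperoctahedral (length (x # xs))"
      using c coxeter_D_subset_B B_inv by force
    moreover have "shift_perm (inv \<tau>) \<in> hyperoctahedral (length (x # xs))"
      using shift_in_D[OF coxeter_D.D_inv[OF \<tau>]] coxeter_D_subset_B by force
    ultimately show ?thesis using sact_comp[OF JJ] sact_shift_perm[OF coxeter_D.D_inv[OF \<tau>]] by metis
  qed
  have "symmetrizer J q g (x # xs) = (\<Sum>\<tau>\<in>coxeter_D ?m. \<Sum>k\<in>coset_idx (Suc ?m).
      complex_of_real (q ^ (D_length ?m \<tau> + coset_len (Suc ?m) k)) *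
      g (sact J (inv (shift_perm \<tau> \<circ> coset_rep (Suc ?m) k)) (x # xs)))"
    unfolding symmetrizer_def list.size add_0_right add_Suc_right
    by (rule sum_coxeter_D_factor[of "\<lambda>l \<sigma>. complex_of_real (q ^ l) * g (sact J (inv \<sigma>) (x # xs))"])
  also have "\<dots> = symmetrizer J q (annih J q x g) xs"
    unfolding symmetrizer_def annih_def
    by (intro sum.cong refl) (simp add: s sum_distrib_left power_add mult.assoc)
  finally show ?thesis .
qed

lemma is_adjoint_annih:
  assumes J: "selfadjoint_involution J"
  shows "is_adjoint J q (creation x) (annih J q x)"
proof -
  have "fock_inner J q (creation x f) g = fock_inner J q f (annih J q x g)"
    if f: "f \<in> Fock" and g: "g \<in> Fock" for f g
    using f
  proof (induction rule: Fock_induct)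
    case zero
    have "creation x (\<lambda>_. 0) = (\<lambda>_. 0)"
      unfolding creation_Fock[OF Fock_0] by (auto simp: create_def fun_eq_iff split: list.splits)
    then show ?case by (simp add: fock_inner_0_left[OF J] g annih_Fock[OF J])
  next
    case (add c xs f)
    have "creation x (\<lambda>zs. c * etens xs zs + f zs) = (\<lambda>zs. c * etens (x # xs) zs + create x f zs)"
      using create_lin[of x c "etens xs" 1 f] add(1)
      by (simp add: creation_Fock Fock_add Fock_scale Fock_etens create_etens)
    then show ?case using add g
      by (simp add: fock_inner_lin_left[OF J] create_Fock annih_Fock[OF J] symmetrizer_Cons[OF J] creation_Fock)
  qed
  then show ?thesis by (simp add: is_adjoint_def fock_linear_def annih_Fock[OF J] annih_lin)
qed

lemma is_adjoint_annihilation: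
  assumes "selfadjoint_involution J"
  shows "is_adjoint J q (creation x) (annihilation J q x)"
  unfolding annihilation_def by (rule someI[of _ "annih J q x"]) (rule is_adjoint_annih[OF assms])

text \<open>
  Equality modulo the radical of the form.
\<close>

definition form_eq :: "('h \<Rightarrow> 'h) \<Rightarrow> real \<Rightarrow> 'h::complex_hilbert tensor \<Rightarrow> 'h tensor \<Rightarrow> bool" where
  "form_eq J q f g \<longleftrightarrow> f \<in> Fock \<and> g \<in> Fock \<and> (\<forall>h\<in>Fock. fock_inner J q h f = fock_inner J q h g)"

text \<open>
  The form determines the values of an adjoint modulo the radical, and the radical is preserved
  since an inner product with \<open>annihilation J q x f\<close> is an inner product with \<open>f\<close>.
\<close>

lemma form_eq_annihilation:
  assumes J: "selfadjoint_involution J" and fg: "form_eq J q f g"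
  shows "form_eq J q (annihilation J q x f) (annih J q x g)"
  using is_adjoint_annihilation[OF J, of q x] is_adjoint_annih[OF J, of q x] fg create_Fock[of _ x]
  by (auto simp: form_eq_def is_adjoint_def fock_linear_def creation_Fock) metis

text \<open>
  By the hermitian symmetry, creation is in turn an adjoint of \<^const>\<open>annih\<close>.
\<close>

lemma form_eq_create:
  assumes J: "selfadjoint_involution J" and fg: "form_eq J q f g"
  shows "form_eq J q (creation x f) (create x g)"
proof -
  have FG: "f \<in> Fock" "g \<in> Fock" using fg by (auto simp: form_eq_def)
  have "fock_inner J q h (create x f) = fock_inner J q h (create x g)" if h: "h \<in> Fock" for h
  proof -
    have e: "fock_inner J q h (create x f) = fock_inner J q (annih J q x h) f" if "f \<in> Fock" for f
    proof -
      have "fock_inner J q h (create x f) = cnj (fock_inner J q (create x f) h)"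
        by (rule fock_inner_commute[OF J h create_Fock[OF that]])
      also have "fock_inner J q (create x f) h = fock_inner J q f (annih J q x h)"
        using is_adjoint_annih[OF J, of q x] that h by (simp add: is_adjoint_def creation_Fock)
      also have "cnj \<dots> = fock_inner J q (annih J q x h) f"
        using fock_inner_commute[OF J annih_Fock[OF J h] that] by simp
      finally show ?thesis .
    qed
    show ?thesis using fg annih_Fock[OF J h] by (simp add: e FG form_eq_def)
  qed
  then show ?thesis using FG by (simp add: form_eq_def creation_Fock create_Fock)
qed

lemma form_eq_lin:
  assumes J: "selfadjoint_involution J" and "form_eq J q f f'" "form_eq J q g g'"
  shows "form_eq J q (\<lambda>zs. a * f zs + b * g zs) (\<lambda>zs. a * f' zs + b * g' zs)"
  using assms by (auto simp: form_eq_def Fock_add Fock_scale fock_inner_lin_right[OF J])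

text \<open>
  The coefficients \<open>a\<close> and \<open>b\<close> specialise to annihilation, creation and their sum.
\<close>

definition field_op :: "('h \<Rightarrow> 'h) \<Rightarrow> real \<Rightarrow> complex \<Rightarrow> complex \<Rightarrow> 'h \<Rightarrow> 'h::complex_hilbert tensor \<Rightarrow> 'h tensor" where
  "field_op J q a b x f = (\<lambda>zs. a * annih J q x f zs + b * create x f zs)"

lemma form_eq_foldr:
  assumes J: "selfadjoint_involution J"
    and T: "\<And>i f. T i f = (\<lambda>zs. \<alpha> i * annihilation J q (x i) f zs + \<beta> i * creation (x i) f zs)"
  shows "form_eq J q (foldr T ks vacuum) (foldr (\<lambda>i. field_op J q (\<alpha> i) (\<beta> i) (x i)) ks vacuum)"
proof (induction ks)
  case Nil
  show ?case by (simp add: form_eq_def vacuum_def Fock_etens)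
next
  case (Cons i ks)
  then show ?case
    by (simp add: T field_op_def form_eq_lin[OF J] form_eq_annihilation[OF J] form_eq_create[OF J])
qed

lemma vacuum_expectation:
  assumes J: "selfadjoint_involution J"
    and T: "\<And>i f. T i f = (\<lambda>zs. \<alpha> i * annihilation J q (x i) f zs + \<beta> i * creation (x i) f zs)"
  shows "fock_inner J q vacuum (foldr T ks vacuum) =
    foldr (\<lambda>i. field_op J q (\<alpha> i) (\<beta> i) (x i)) ks vacuum []"
proof -
  let ?g = "foldr (\<lambda>i. field_op J q (\<alpha> i) (\<beta> i) (x i)) ks vacuum"
  have e: "form_eq J q (foldr T ks vacuum) ?g" using form_eq_foldr[OF J T] .
  then have "fock_inner J q vacuum (foldr T ks vacuum) = fock_inner J q (etens []) ?g"
    by (auto simp: form_eq_def vacuum_def Fock_etens)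
  also have "\<dots> = symmetrizer J q ?g []" using e by (intro fock_inner_etens[OF J]) (simp add: form_eq_def)
  also have "\<dots> = ?g []" by (simp add: symmetrizer_def coxeter_D_trivial D_length_0 sact_def)
  finally show ?thesis .
qed

section \<open>Peeling off one pair of a pair partition\<close>

text \<open>
  The coloured pair partitions that can still arise when the positions in \<open>S\<close>, all greater than
  \<open>i\<close>, wait for a partner, the positions \<open>1, \<dots>, i\<close> have not been treated, and \<open>b\<close> tells whether an
  odd number of negative pairs has been formed to the right. The waiting positions are maxima of
  their pairs, whence the condition on the minima.
\<close>

definition completions :: "nat \<Rightarrow> nat set \<Rightarrow> bool \<Rightarrow> (nat set set \<times> (nat set \<Rightarrow> int)) set" where
  "completions i S b = {(\<pi>, f). partition_on ({1..i} \<union> S) \<pi> \<and> (\<forall>V\<in>\<pi>. card V = 2 \<and> Min V \<le> i) \<and>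
     f \<in> \<pi> \<rightarrow>\<^sub>E {1, - 1} \<and>
     (\<forall>V\<in>\<pi>. lcr \<pi> V = 0 \<and> cover \<pi> V = 0 \<longrightarrow> f V = (- 1) ^ (npr \<pi> f V + of_bool b))}"

text \<open>
  The contribution of a pair partition when creation at position \<open>i\<close> has the coefficient \<open>\<beta> i\<close> and
  annihilation has the coefficient \<open>\<alpha> i\<close>.
\<close>

definition amplitude where
  "amplitude J q x \<alpha> \<beta> \<pi> f = (\<Prod>V\<in>\<pi>. \<alpha> (Min V) * \<beta> (Max V)) * pair_weight J q x \<pi> f"

lemma card_2_Min_Max:
  assumes "card V = 2"
  shows "V = {Min V, Max V}" "Min V < (Max V :: 'a::linorder)"
proof -
  obtain a b where V: "V = {a, b}" "a \<noteq> b" using assms by (auto simp: card_2_iff)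
  then show "V = {Min V, Max V}" by (cases "a < b") (auto simp: min_def max_def)
  show "Min V < Max V" using V by (auto simp: min_def max_def)
qed

lemma lcr_pairs:
  assumes "\<forall>W\<in>\<pi>. card W = 2" "card V = 2"
  shows "lcr \<pi> V = card {W \<in> \<pi>. Min W < Min V \<and> Min V < Max W \<and> Max W < Max V}"
proof -
  have "(\<exists>i\<in>V. \<exists>j\<in>V. \<exists>k\<in>W. \<exists>l\<in>W. k < i \<and> i < l \<and> l < j) \<longleftrightarrow>
      Min W < Min V \<and> Min V < Max W \<and> Max W < Max V" if W: "W \<in> \<pi>" for W
  proof -
    obtain a b where V: "V = {a, b}" "a < b" "Min V = a" "Max V = b" using card_2_Min_Max[OF assms(2)] by metis
    obtain c d where W: "W = {c, d}" "c < d" "Min W = c" "Max W = d" using card_2_Min_Max[of W] assms(1) W by metis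
    show ?thesis unfolding V(3,4) W(3,4) unfolding V(1) W(1) using V(2) W(2) by auto
  qed
  then have "{W \<in> \<pi>. \<exists>i\<in>V. \<exists>j\<in>V. \<exists>k\<in>W. \<exists>l\<in>W. k < i \<and> i < l \<and> l < j} =
      {W \<in> \<pi>. Min W < Min V \<and> Min V < Max W \<and> Max W < Max V}"
    by (intro Collect_cong conj_cong refl)
  then show ?thesis by (simp only: lcr_def)
qed

lemma covers_pairs:
  assumes "card W = 2" "card V = 2"
  shows "covers W V \<longleftrightarrow> Min W < Min V \<and> Max V < Max W"
proof -
  obtain a b where V: "V = {a, b}" "a < b" "Min V = a" "Max V = b" using card_2_Min_Max[OF assms(2)] by metis
  obtain c d where W: "W = {c, d}" "c < d" "Min W = c" "Max W = d" using card_2_Min_Max[OF assms(1)] by metis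
  show ?thesis unfolding V(3,4) W(3,4) unfolding covers_def V(1) W(1) using V(2) W(2) by auto
qed

lemma cnp_sum:
  assumes "finite \<pi>"
  shows "cnp \<pi> f = (\<Sum>V\<in>{V \<in> \<pi>. f V = - 1}. cover \<pi> V)"
proof -
  have "{(V, W). V \<in> \<pi> \<and> W \<in> \<pi> \<and> f V = - 1 \<and> covers W V} = (SIGMA V:{V \<in> \<pi>. f V = - 1}. {W \<in> \<pi>. covers W V})"
    by auto
  then show ?thesis using assms by (simp add: cnp_def cover_def)
qed

definition colour :: "bool \<Rightarrow> int" where "colour p = (if p then - 1 else 1)"

lemma colour_simps [simp]: "colour p = - 1 \<longleftrightarrow> p" "colour p = 1 \<longleftrightarrow> \<not> p" "colour p = colour p' \<longleftrightarrow> p = p'"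
  by (auto simp: colour_def)

lemma power_colour: "(- 1) ^ (n + of_bool b) = colour (odd n \<noteq> b)"
  by (cases "even n") (auto simp: colour_def)

text \<open>
  A pair \<open>V = {i + 1, j}\<close> is added to a pair partition \<open>\<pi>\<close> all of whose minima are at most \<open>i\<close>. As
  \<open>V\<close> has the largest minimum, it neither crosses an old pair from the left nor covers one, and
  the statistics of the old pairs do not change, except that \<open>V\<close> may be a negative pair on their
  right. Those of \<open>V\<close> are determined by \<open>j\<close> and \<open>S\<close>.
\<close>

context
  fixes i j :: nat and S :: "nat set" and \<pi> :: "nat set set" and f :: "nat set \<Rightarrow> int" and b p :: bool and V
  assumes S: "finite S" "\<And>l. l \<in> S \<Longrightarrow> Suc i < l" and j: "j \<in> S"
    and part: "partition_on ({1..i} \<union> (S - {j})) \<pi>" and c2: "\<And>W. W \<in> \<pi> \<Longrightarrow> card W = 2"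
    and Min_le: "\<And>W. W \<in> \<pi> \<Longrightarrow> Min W \<le> i" and f: "f \<in> \<pi> \<rightarrow>\<^sub>E {1, - 1}"
    and V: "V = {Suc i, j}"
begin

lemma new_pair: "card V = 2" "Min V = Suc i" "Max V = j" "Suc i < j" "V \<notin> \<pi>"
proof -
  show ij: "Suc i < j" using S j by auto
  then show "card V = 2" "Min V = Suc i" "Max V = j" by (auto simp: V)
  then show "V \<notin> \<pi>" using Min_le[of V] by auto
qed

lemma finite_old_pairs: "finite \<pi>"
  using part S(1) by (intro finite_elements[OF _ part]) auto

lemma card_insert_pair: "W \<in> insert V \<pi> \<Longrightarrow> card W = 2"
  using c2 new_pair by auto

lemma lcr_old:
  assumes W: "W \<in> \<pi>"
  shows "lcr (insert V \<pi>) W = lcr \<pi> W"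
proof -
  have "\<not> Min V < Min W" using Min_le[OF W] new_pair(2) by simp
  then have e: "{U \<in> insert V \<pi>. Min U < Min W \<and> Min W < Max U \<and> Max U < Max W} =
      {U \<in> \<pi>. Min U < Min W \<and> Min W < Max U \<and> Max U < Max W}"
    by blast
  have "lcr (insert V \<pi>) W = card {U \<in> insert V \<pi>. Min U < Min W \<and> Min W < Max U \<and> Max U < Max W}"
    using card_insert_pair c2[OF W] by (intro lcr_pairs) simp_all
  moreover have "lcr \<pi> W = card {U \<in> \<pi>. Min U < Min W \<and> Min W < Max U \<and> Max U < Max W}"
    using c2 c2[OF W] by (intro lcr_pairs) simp_all
  ultimately show ?thesis unfolding e by (rule trans[OF _ sym])
qed

lemma cover_old:
  assumes W: "W \<in> \<pi>"
  shows "cover (insert V \<pi>) W = cover \<pi> W"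
proof -
  have "\<not> covers V W" using covers_pairs[OF new_pair(1) c2[OF W]] Min_le[OF W] new_pair(2) by simp
  then have "{U \<in> insert V \<pi>. covers U W} = {U \<in> \<pi>. covers U W}" by blast
  then show ?thesis by (simp only: cover_def)
qed

text \<open>
  A waiting position is the maximum of exactly one old pair. Hence old pairs that start before
  \<open>i + 1\<close> and end in a given set of waiting positions can be counted by that set.
\<close>

lemma card_Max_in:
  assumes "T \<subseteq> S - {j}"
  shows "card {W \<in> \<pi>. Max W \<in> T} = card T"
proof (rule bij_betw_same_card[of Max])
  show "bij_betw Max {W \<in> \<pi>. Max W \<in> T} T"
    unfolding bij_betw_def
  proof
    show "inj_on Max {W \<in> \<pi>. Max W \<in> T}"
    proof
      fix U W assume UW: "U \<in> {W \<in> \<pi>. Max W \<in> T}" "W \<in> {W \<in> \<pi>. Max W \<in> T}" and e: "Max U = Max W"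
      then have "Max U \<in> U" "Max W \<in> W" using card_2_Min_Max(1)[OF c2] by blast+
      then show "U = W" using e UW partition_onD2[OF part] by (auto simp: disjoint_def)
    qed
    show "Max ` {W \<in> \<pi>. Max W \<in> T} = T"
    proof
      show "T \<subseteq> Max ` {W \<in> \<pi>. Max W \<in> T}"
      proof
        fix l assume l: "l \<in> T"
        then have "l \<in> \<Union>\<pi>" using partition_onD1[OF part] assms by auto
        then obtain W where W: "W \<in> \<pi>" "l \<in> W" by auto
        have "Suc i < l" using l assms S(2) by auto
        then have "l \<noteq> Min W" using Min_le[OF W(1)] by auto
        then have "l = Max W" using card_2_Min_Max(1)[OF c2[OF W(1)]] W(2) by blast
        then show "l \<in> Max ` {W \<in> \<pi>. Max W \<in> T}" using W l by auto
      qed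
    qed auto
  qed
qed

lemma Max_in: "W \<in> \<pi> \<Longrightarrow> Max W \<le> i \<or> Max W \<in> S - {j}"
proof -
  assume W: "W \<in> \<pi>"
  then have "Max W \<in> W" using card_2_Min_Max(1)[OF c2] by blast
  then show ?thesis using W partition_onD1[OF part] by auto
qed

lemma lcr_new: "lcr (insert V \<pi>) V = card {l \<in> S. l < j}"
proof -
  have "Min W < Min V \<and> Min V < Max W \<and> Max W < Max V \<longleftrightarrow> Max W \<in> {l \<in> S. l < j}" if W: "W \<in> \<pi>" for W
    using new_pair(2-4) Min_le[OF W] Max_in[OF W] S(2)[of "Max W"] by auto
  then have e: "{W \<in> insert V \<pi>. Min W < Min V \<and> Min V < Max W \<and> Max W < Max V} =
      {W \<in> \<pi>. Max W \<in> {l \<in> S. l < j}}" by blast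
  have "lcr (insert V \<pi>) V = card {W \<in> insert V \<pi>. Min W < Min V \<and> Min V < Max W \<and> Max W < Max V}"
    using card_insert_pair new_pair(1) by (intro lcr_pairs) simp_all
  also have "\<dots> = card {l \<in> S. l < j}" unfolding e by (rule card_Max_in) auto
  finally show ?thesis .
qed

lemma cover_new: "cover (insert V \<pi>) V = card {l \<in> S. j < l}"
proof -
  have "covers W V \<longleftrightarrow> Max W \<in> {l \<in> S. j < l}" if W: "W \<in> \<pi>" for W
    using covers_pairs[OF c2[OF W] new_pair(1)] new_pair(2-4) Min_le[OF W] Max_in[OF W] by auto
  moreover have "\<not> covers V V" using covers_pairs[OF new_pair(1) new_pair(1)] by simp
  ultimately have "{W \<in> insert V \<pi>. covers W V} = {W \<in> \<pi>. Max W \<in> {l \<in> S. j < l}}" by blast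
  then have "cover (insert V \<pi>) V = card {W \<in> \<pi>. Max W \<in> {l \<in> S. j < l}}" by (simp only: cover_def)
  also have "\<dots> = card {l \<in> S. j < l}" by (rule card_Max_in) auto
  finally show ?thesis .
qed

lemma npr_old: "W \<in> \<pi> \<Longrightarrow> npr (insert V \<pi>) (f(V := colour p)) W = npr \<pi> f W + of_bool p"
proof -
  assume W: "W \<in> \<pi>"
  have "{U \<in> insert V \<pi>. (f(V := colour p)) U = - 1 \<and> Min W < Min U} =
      (if p then {V} else {}) \<union> {U \<in> \<pi>. f U = - 1 \<and> Min W < Min U}"
    using new_pair(2,5) Min_le[OF W] by (auto split: if_splits)
  then show ?thesis using new_pair(5) finite_old_pairs by (simp add: npr_def)
qed

lemma npr_new: "npr (insert V \<pi>) (f(V := colour p)) V = 0"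
proof -
  have "\<not> Min V < Min W" if "W \<in> insert V \<pi>" for W using that new_pair(2) Min_le[of W] by auto
  then have "{W \<in> insert V \<pi>. (f(V := colour p)) W = - 1 \<and> Min V < Min W} = {}" by blast
  then show ?thesis by (simp only: npr_def card.empty)
qed

lemma cr_insert: "cr (insert V \<pi>) = cr \<pi> + card {l \<in> S. l < j}"
  using new_pair finite_old_pairs by (simp add: cr_def lcr_new lcr_old)

lemma cnp_insert: "cnp (insert V \<pi>) (f(V := colour p)) = cnp \<pi> f + (if p then card {l \<in> S. j < l} else 0)"
proof -
  have e: "{U \<in> insert V \<pi>. (f(V := colour p)) U = - 1} = (if p then {V} else {}) \<union> {U \<in> \<pi>. f U = - 1}"
    using new_pair by auto
  have "(\<Sum>U\<in>{U \<in> \<pi>. f U = - 1}. cover (insert V \<pi>) U) = (\<Sum>U\<in>{U \<in> \<pi>. f U = - 1}. cover \<pi> U)"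
    by (intro sum.cong) (auto simp: cover_old)
  then show ?thesis
    using new_pair(5) finite_old_pairs unfolding cnp_sum[OF finite_old_pairs] cnp_sum[OF finite.insertI[OF finite_old_pairs]] e
    by (simp add: cover_new)
qed

text \<open>
  The new pair is constrained exactly if \<open>j\<close> is the only waiting position, since the other waiting
  positions are those that cross or cover it. Its sign changes the parity seen by the old pairs.
\<close>

lemma new_type_D:
  "(\<forall>W\<in>insert V \<pi>. lcr (insert V \<pi>) W = 0 \<and> cover (insert V \<pi>) W = 0 \<longrightarrow>
      (f(V := colour p)) W = (- 1) ^ (npr (insert V \<pi>) (f(V := colour p)) W + of_bool b)) \<longleftrightarrow>
   (\<forall>W\<in>\<pi>. lcr \<pi> W = 0 \<and> cover \<pi> W = 0 \<longrightarrow> f W = (- 1) ^ (npr \<pi> f W + of_bool (b \<noteq> p))) \<and>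
   (card S = 1 \<longrightarrow> p = b)"
proof -
  have "S = insert j ({l \<in> S. l < j} \<union> {l \<in> S. j < l})" using j by auto
  then have "card S = Suc (card ({l \<in> S. l < j} \<union> {l \<in> S. j < l}))"
    using S(1) by (metis (no_types, lifting) card_insert_disjoint finite_Un finite_insert Un_iff mem_Collect_eq less_irrefl)
  also have "card ({l \<in> S. l < j} \<union> {l \<in> S. j < l}) = card {l \<in> S. l < j} + card {l \<in> S. j < l}"
    using S(1) by (intro card_Un_disjoint) auto
  \<comment> \<open>both statistics vanish exactly if \<open>j\<close> is the only element of \<open>S\<close>\<close>
  finally have cS: "card S = 1 \<longleftrightarrow> lcr (insert V \<pi>) V = 0 \<and> cover (insert V \<pi>) V = 0"
    by (simp add: lcr_new cover_new)
  have "f W = (- 1) ^ (npr (insert V \<pi>) (f(V := colour p)) W + of_bool b) \<longleftrightarrow>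
      f W = (- 1) ^ (npr \<pi> f W + of_bool (b \<noteq> p))" if "W \<in> \<pi>" for W
    unfolding npr_old[OF that] power_colour by (cases p) (auto simp: colour_def)
  moreover have "W \<noteq> V" if "W \<in> \<pi>" for W using that new_pair by auto
  moreover have "colour p = (- 1) ^ (npr (insert V \<pi>) (f(V := colour p)) V + of_bool b) \<longleftrightarrow> p = b"
    unfolding npr_new power_colour by simp
  ultimately show ?thesis unfolding ball_simps cS fun_upd_same
    by (auto simp: lcr_old cover_old)
qed

lemma partition_insert_pair: "partition_on ({1..Suc i} \<union> S) (insert V \<pi>)"
proof -
  have "({1..Suc i} \<union> S) - V = {1..i} \<union> (S - {j})" using new_pair(4) S(2)[of "Suc i"] S(2)
    unfolding V by force
  moreover have "disjnt V (\<Union>\<pi>)"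
    using new_pair(4) S(2)[of "Suc i"] unfolding partition_onD1[OF part, symmetric] V by (auto simp: disjnt_def)
  moreover have "V \<subseteq> {1..Suc i} \<union> S" "V \<noteq> {}" using j by (auto simp: V)
  ultimately show ?thesis using part by (simp add: partition_on_insert)
qed

lemma insert_in_completions:
  "(insert V \<pi>, f(V := colour p)) \<in> completions (Suc i) S b \<longleftrightarrow> (\<pi>, f) \<in> completions i (S - {j}) (b \<noteq> p) \<and> (card S = 1 \<longrightarrow> p = b)"
proof -
  have "f(V := colour p) \<in> insert V \<pi> \<rightarrow>\<^sub>E {1, - 1}"
    using f by (auto simp: PiE_def Pi_def extensional_def colour_def)
  moreover have "\<forall>W\<in>insert V \<pi>. card W = 2 \<and> Min W \<le> Suc i" using card_insert_pair new_pair Min_le by fastforce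
  ultimately show ?thesis
    using partition_insert_pair part c2 Min_le f new_type_D unfolding completions_def by auto
qed

lemma amplitude_insert:
  "amplitude J q x \<alpha> \<beta> (insert V \<pi>) (f(V := colour p)) =
     \<alpha> (Suc i) * \<beta> j * complex_of_real (q ^ (card {l \<in> S. l < j} + (if p then 2 * card {l \<in> S. j < l} else 0))) *
     cinner (x (Suc i)) ((if p then J else id) (x j)) * amplitude J q x \<alpha> \<beta> \<pi> f"
proof -
  let ?f = "f(V := colour p)"
  have pos: "{U \<in> insert V \<pi>. ?f U = 1} = (if p then {} else {V}) \<union> {U \<in> \<pi>. f U = 1}"
    and neg: "{U \<in> insert V \<pi>. ?f U = - 1} = (if p then {V} else {}) \<union> {U \<in> \<pi>. f U = - 1}"
    using new_pair(5) by auto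
  have "pair_weight J q x (insert V \<pi>) ?f =
     complex_of_real (q ^ (card {l \<in> S. l < j} + (if p then 2 * card {l \<in> S. j < l} else 0))) *
     cinner (x (Suc i)) ((if p then J else id) (x j)) * pair_weight J q x \<pi> f"
    using new_pair finite_old_pairs unfolding pair_weight_def pos neg cr_insert cnp_insert
    by (cases p) (simp_all add: power_add algebra_simps)
  then show ?thesis
    using new_pair finite_old_pairs by (simp add: amplitude_def algebra_simps)
qed

end

lemma finite_completions:
  assumes "finite S" shows "finite (completions i S b)"
proof (rule finite_subset)
  let ?A = "{1..i} \<union> S"
  show "completions i S b \<subseteq> (SIGMA \<pi>:Pow (Pow ?A). \<pi> \<rightarrow>\<^sub>E {1, - 1})"
    by (auto simp: completions_def dest: partition_onD1)
  show "finite (SIGMA \<pi>:Pow (Pow ?A). \<pi> \<rightarrow>\<^sub>E {1, - 1 :: int})"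
    using assms by (intro finite_SigmaI finite_PiE) (auto intro: finite_subset)
qed

text \<open>
  Signs are encoded by whether they are negative. A pair that uses up the only waiting position is
  neither crossed from the left nor covered, so the type D condition determines its sign.
\<close>

definition colours :: "nat set \<Rightarrow> bool \<Rightarrow> bool set" where
  "colours S b = (if card S = 1 then {b} else UNIV)"

definition add_pair where
  "add_pair i = (\<lambda>(j, p, \<pi>, f). (insert {Suc i, j} \<pi>, f({Suc i, j} := colour p)))"

text \<open>
  If no pair starts at \<open>i + 1\<close>, this position is a maximum, i.e. it joins the waiting ones.
\<close>

lemma completions_Max:
  assumes S: "\<And>l. l \<in> S \<Longrightarrow> Suc i < l"
  shows "{(\<pi>, f) \<in> completions (Suc i) S b. \<forall>V\<in>\<pi>. Min V \<le> i} = completions i (insert (Suc i) S) b"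
proof -
  have "{1..Suc i} \<union> S = {1..i} \<union> insert (Suc i) S" by auto
  then show ?thesis unfolding completions_def by auto
qed

text \<open>
  Otherwise its partner is a waiting position, and removing the pair leaves a completion for the
  remaining waiting positions.
\<close>

lemma completions_Min:
  assumes S: "finite S" "\<And>l. l \<in> S \<Longrightarrow> Suc i < l"
  shows "bij_betw (add_pair i) (SIGMA j:S. SIGMA p:colours S b. completions i (S - {j}) (b \<noteq> p))
    {(\<pi>, f) \<in> completions (Suc i) S b. \<not> (\<forall>V\<in>\<pi>. Min V \<le> i)}"
  (is "bij_betw _ ?A ?B")
  unfolding bij_betw_def
proof
  have A: "j \<in> S" "partition_on ({1..i} \<union> (S - {j})) \<pi>" "\<And>W. W \<in> \<pi> \<Longrightarrow> card W = 2"
    "\<And>W. W \<in> \<pi> \<Longrightarrow> Min W \<le> i" "f \<in> \<pi> \<rightarrow>\<^sub>E {1, - 1}" "(\<pi>, f) \<in> completions i (S - {j}) (b \<noteq> p)"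
    "card S = 1 \<longrightarrow> p = b"
    if "(j, p, \<pi>, f) \<in> ?A" for j p \<pi> f
    using that by (auto simp: completions_def colours_def split: if_splits)
  show "inj_on (add_pair i) ?A"
  proof
    fix a a' assume a: "a \<in> ?A" "a' \<in> ?A" and e: "add_pair i a = add_pair i a'"
    obtain j p \<pi> f where a1: "a = (j, p, \<pi>, f)" by (cases a) auto
    obtain j' p' \<pi>' f' where a2: "a' = (j', p', \<pi>', f')" by (cases a') auto
    let ?V = "{Suc i, j}" and ?V' = "{Suc i, j'}"
    note A1 = A[OF a(1)[unfolded a1]] and A2 = A[OF a(2)[unfolded a2]]
    note V1 = new_pair[OF S A1(1-5) refl] and V2 = new_pair[OF S A2(1-5) refl]
    have e1: "insert ?V \<pi> = insert ?V' \<pi>'" and e2: "f(?V := colour p) = f'(?V' := colour p')"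
      using e by (auto simp: a1 a2 add_pair_def)
    have "?V \<notin> \<pi>'" using A2(4)[of ?V] V1(2) by auto
    then have V: "?V = ?V'" using e1 by blast
    then have j: "j = j'" by (auto simp: doubleton_eq_iff)
    have \<pi>: "\<pi> = \<pi>'" using e1 V V1(5) V2(5) by (metis insert_ident)
    have p: "p = p'" using fun_cong[OF e2, of ?V] V by simp
    have "f = f'"
    proof
      fix U
      show "f U = f' U"
      proof (cases "U = ?V")
        case True
        then have "U \<notin> \<pi>" "U \<notin> \<pi>'" using V1(5) \<pi> by auto
        then show ?thesis using A1(5) A2(5) by (simp add: PiE_def extensional_def)
      next
        case False
        then show ?thesis using fun_cong[OF e2, of U] V by simp
      qed
    qed
    then show "a = a'" using j \<pi> p a1 a2 by simp
  qed
  show "add_pair i ` ?A = ?B"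
  proof
    show "add_pair i ` ?A \<subseteq> ?B"
    proof
      fix y assume "y \<in> add_pair i ` ?A"
      then obtain j p \<pi> f where a: "(j, p, \<pi>, f) \<in> ?A" and y: "y = add_pair i (j, p, \<pi>, f)" by auto
      note A = A[OF a]
      show "y \<in> ?B"
        using insert_in_completions[OF S A(1-5) refl, of p b] A(6,7) new_pair(2)[OF S A(1-5) refl]
        by (auto simp: y add_pair_def)
    qed
    show "?B \<subseteq> add_pair i ` ?A"
    proof
      fix y assume "y \<in> ?B"
      then obtain \<pi> f V where y: "y = (\<pi>, f)" and completions: "(\<pi>, f) \<in> completions (Suc i) S b" and V: "V \<in> \<pi>" "\<not> Min V \<le> i"
        by auto
      have part: "partition_on ({1..Suc i} \<union> S) \<pi>" and c2: "\<And>W. W \<in> \<pi> \<Longrightarrow> card W = 2"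
        and Min_le: "\<And>W. W \<in> \<pi> \<Longrightarrow> Min W \<le> Suc i" and f: "f \<in> \<pi> \<rightarrow>\<^sub>E {1, - 1}"
        using completions by (auto simp: completions_def)
      define j where "j = Max V"
      have Vj: "V = {Suc i, j}" "Suc i < j"
        using card_2_Min_Max[OF c2[OF V(1)]] Min_le[OF V(1)] V(2) unfolding j_def by (metis le_Suc_eq)+
      have "j \<in> V" by (simp add: Vj(1))
  then have "j \<in> {1..Suc i} \<union> S" using partition_onD1[OF part] V(1) by blast
  then have j: "j \<in> S" using Vj(2) by auto
      define \<pi>' where "\<pi>' = \<pi> - {V}"
      have \<pi>: "\<pi> = insert V \<pi>'" "V \<notin> \<pi>'" using V(1) by (auto simp: \<pi>'_def)
      have disj: "U \<inter> W = {}" if "U \<in> \<pi>" "W \<in> \<pi>" "U \<noteq> W" for U W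
        using partition_onD2[OF part] that by (auto simp: disjoint_def)
      have "\<Union>\<pi>' = \<Union>\<pi> - V" using disj[OF V(1)] unfolding \<pi>'_def by blast
      also have "\<dots> = {1..i} \<union> (S - {j})"
      proof -
        have e: "\<Union>\<pi> = {1..Suc i} \<union> S" using partition_onD1[OF part] by simp
        have "j \<notin> {1..i}" "Suc i \<notin> S" using Vj(2) S(2)[of "Suc i"] by auto
        moreover have "{1..Suc i} = insert (Suc i) {1..i}" "Suc i \<notin> {1..i}" by auto
        ultimately show ?thesis unfolding e Vj(1) by blast
      qed
      finally have part': "partition_on ({1..i} \<union> (S - {j})) \<pi>'"
        using part unfolding partition_on_def \<pi>'_def disjoint_def by blast
      have Min': "Min W \<le> i" if W: "W \<in> \<pi>'" for W
      proof (rule ccontr)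
        assume "\<not> Min W \<le> i"
        then have "Suc i = Min W" using Min_le[of W] W by (auto simp: \<pi>'_def)
        then have "Suc i \<in> W" using card_2_Min_Max(1)[OF c2[of W]] W by (auto simp: \<pi>'_def)
        then show False using disj[OF V(1), of W] W Vj(1) by (auto simp: \<pi>'_def)
      qed
      define p where "p \<longleftrightarrow> f V = - 1"
      define f' where "f' = f(V := undefined)"
      have fp: "f = f'(V := colour p)"
        using f V(1) by (auto simp: f'_def p_def colour_def fun_eq_iff)
      have f': "f' \<in> \<pi>' \<rightarrow>\<^sub>E {1, - 1}"
        using f \<pi> by (auto simp: f'_def PiE_def Pi_def extensional_def)
      have c2': "\<And>W. W \<in> \<pi>' \<Longrightarrow> card W = 2" using c2 by (auto simp: \<pi>'_def)
      have "(\<pi>', f') \<in> completions i (S - {j}) (b \<noteq> p) \<and> (card S = 1 \<longrightarrow> p = b)"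
        using completions insert_in_completions[OF S j part' c2' Min' f' Vj(1), of p b] \<pi>(1) fp by metis
      then have "(j, p, \<pi>', f') \<in> ?A" using j by (auto simp: colours_def)
      moreover have "y = add_pair i (j, p, \<pi>', f')" using \<pi>(1) fp by (simp add: y add_pair_def Vj(1)[symmetric])
      ultimately show "y \<in> add_pair i ` ?A" by blast
    qed
  qed
qed

lemma sum_completions_Suc:
  assumes fin: "finite S" and above: "\<forall>l\<in>S. Suc i < l"
  shows "(\<Sum>(\<pi>, f)\<in>completions (Suc i) S b. amplitude J q x \<alpha> \<beta> \<pi> f) =
    (\<Sum>(\<pi>, f)\<in>completions i (insert (Suc i) S) b. amplitude J q x \<alpha> \<beta> \<pi> f) +
    (\<Sum>j\<in>S. \<Sum>p\<in>colours S b.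
       \<alpha> (Suc i) * \<beta> j * complex_of_real (q ^ (card {l \<in> S. l < j} + (if p then 2 * card {l \<in> S. j < l} else 0))) *
       cinner (x (Suc i)) ((if p then J else id) (x j)) *
       (\<Sum>(\<pi>, f)\<in>completions i (S - {j}) (b \<noteq> p). amplitude J q x \<alpha> \<beta> \<pi> f))"
proof -
  have S: "finite S" "\<And>l. l \<in> S \<Longrightarrow> Suc i < l" using fin above by auto
  let ?w = "\<lambda>(\<pi>, f). amplitude J q x \<alpha> \<beta> \<pi> f"
  let ?A = "SIGMA j:S. SIGMA p:colours S b. completions i (S - {j}) (b \<noteq> p)"
  let ?B = "{(\<pi>, f) \<in> completions (Suc i) S b. \<not> (\<forall>V\<in>\<pi>. Min V \<le> i)}"
  let ?c = "\<lambda>j p. \<alpha> (Suc i) * \<beta> j * complex_of_real (q ^ (card {l \<in> S. l < j} + (if p then 2 * card {l \<in> S. j < l} else 0))) *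
       cinner (x (Suc i)) ((if p then J else id) (x j))"
  have "completions (Suc i) S b = {(\<pi>, f) \<in> completions (Suc i) S b. \<forall>V\<in>\<pi>. Min V \<le> i} \<union> ?B" by auto
  then have U: "completions (Suc i) S b = completions i (insert (Suc i) S) b \<union> ?B" by (simp only: completions_Max[OF S(2)])
  have "sum ?w (completions (Suc i) S b) = sum ?w (completions i (insert (Suc i) S) b) + sum ?w ?B"
  proof (subst U, rule sum.union_disjoint)
    show "finite (completions i (insert (Suc i) S) b)" using S(1) by (intro finite_completions) simp
    show "finite ?B" by (rule finite_subset[OF _ finite_completions[OF S(1), of "Suc i" b]]) auto
    show "completions i (insert (Suc i) S) b \<inter> ?B = {}" by (auto simp: completions_def)
  qed
  also have "sum ?w ?B = (\<Sum>a\<in>?A. ?w (add_pair i a))"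
    by (rule sum.reindex_bij_betw[OF completions_Min[OF S], symmetric])
  also have "\<dots> = (\<Sum>(j, p, \<pi>, f)\<in>?A. ?c j p * amplitude J q x \<alpha> \<beta> \<pi> f)"
  proof (rule sum.cong[OF refl])
    fix a assume "a \<in> ?A"
    then obtain j p \<pi> f where a: "a = (j, p, \<pi>, f)" and j: "j \<in> S" and completions: "(\<pi>, f) \<in> completions i (S - {j}) (b \<noteq> p)"
      by auto
    have "partition_on ({1..i} \<union> (S - {j})) \<pi>" "\<And>W. W \<in> \<pi> \<Longrightarrow> card W = 2"
      "\<And>W. W \<in> \<pi> \<Longrightarrow> Min W \<le> i" "f \<in> \<pi> \<rightarrow>\<^sub>E {1, - 1}"
      using completions by (auto simp: completions_def)
    then have "amplitude J q x \<alpha> \<beta> (insert {Suc i, j} \<pi>) (f({Suc i, j} := colour p)) =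
        ?c j p * amplitude J q x \<alpha> \<beta> \<pi> f"
      by (intro amplitude_insert[OF S j _ _ _ _ refl])
    then show "?w (add_pair i a) = (case a of (j, p, \<pi>, f) \<Rightarrow> ?c j p * amplitude J q x \<alpha> \<beta> \<pi> f)"
      by (simp only: a add_pair_def prod.case)
  qed
  also have "\<dots> = (\<Sum>j\<in>S. \<Sum>(p, \<pi>, f)\<in>(SIGMA p:colours S b. completions i (S - {j}) (b \<noteq> p)).
      ?c j p * amplitude J q x \<alpha> \<beta> \<pi> f)"
    using S(1) by (intro sum.Sigma[symmetric]) (auto intro!: finite_SigmaI finite_completions)
  also have "\<dots> = (\<Sum>j\<in>S. \<Sum>p\<in>colours S b. \<Sum>(\<pi>, f)\<in>completions i (S - {j}) (b \<noteq> p).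
      ?c j p * amplitude J q x \<alpha> \<beta> \<pi> f)"
    using S(1) by (intro sum.cong[OF refl] sum.Sigma[symmetric]) (auto intro!: finite_completions)
  finally show ?thesis by (simp add: sum_distrib_left case_prod_unfold)
qed

lemma completions_0:
  assumes "0 \<notin> S"
  shows "completions 0 S b = (if S = {} then {({}, \<lambda>_. undefined)} else {})"
proof -
  have "\<pi> = {} \<and> S = {}" if a: "(\<pi>, f) \<in> completions 0 S b" for \<pi> f
  proof -
    have part: "partition_on S \<pi>" using a by (simp add: completions_def)
    have "False" if V: "V \<in> \<pi>" for V
    proof -
      have "card V = 2" "Min V = 0" "V \<subseteq> S" using a V partition_onD1[OF part] by (auto simp: completions_def)
      then have "0 \<in> S" using card_2_Min_Max(1)[of V] by auto
      then show False using assms by simp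
    qed
    then show ?thesis using partition_onD1[OF part] by auto
  qed
  note empty = this
  show ?thesis
  proof (cases "S = {}")
    case True
    have "a \<in> completions 0 {} b \<longleftrightarrow> a = ({}, \<lambda>_. undefined)" for a
    proof
      assume a: "a \<in> completions 0 {} b"
      obtain \<pi> f where a': "a = (\<pi>, f)" by fastforce
      then have \<pi>: "\<pi> = {}" using empty a True by blast
      have "f \<in> \<pi> \<rightarrow>\<^sub>E {1, - 1}" using a by (simp add: a' completions_def)
      then show "a = ({}, \<lambda>_. undefined)" by (simp add: a' \<pi>)
    next
      assume a: "a = ({}, \<lambda>_. undefined)"
      show "a \<in> completions 0 {} b" by (simp add: a completions_def partition_on_empty)
    qed
    then have "completions 0 {} b = {({}, \<lambda>_. undefined)}" by blast
    then show ?thesis using True by simp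
  next
    case False
    then have "a \<notin> completions 0 S b" for a using empty by (cases a) blast
    then show ?thesis using False by auto
  qed
qed

section \<open>Vacuum expectations\<close>

text \<open>
  The tuples that occur in the computation of a vacuum expectation: the vectors at the waiting
  positions \<open>js\<close>, the last one being replaced by its image under the involution if \<open>b\<close> holds.
\<close>

definition state :: "('h \<Rightarrow> 'h) \<Rightarrow> (nat \<Rightarrow> 'h) \<Rightarrow> bool \<Rightarrow> nat list \<Rightarrow> 'h list" where
  "state J x b js = (if b then apply_last J (map x js) else map x js)"

lemma length_state [simp]: "length (state J x b js) = length js"
  by (simp add: state_def)

lemma state_Nil [simp]: "state J x b [] = []"
  by (simp add: state_def apply_last_def)

lemma state_Cons: "js \<noteq> [] \<or> \<not> b \<Longrightarrow> state J x b (j # js) = x j # state J x b js"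
  by (cases js) (auto simp: state_def apply_last_def)

lemma state_nth: "i < length js \<Longrightarrow> state J x b js ! i = (if b \<and> Suc i = length js then J (x (js ! i)) else x (js ! i))"
  by (auto simp: state_def apply_last_def nth_list_update)

lemma apply_last_state:
  assumes "\<And>y. J (J y) = y"
  shows "apply_last J (state J x b js) = state J x (\<not> b) js"
proof (cases "js = []")
  case False
  then show ?thesis by (auto simp: state_def apply_last_def assms list_update_same_conv)
qed (simp add: apply_last_def)

lemma delete_state:
  assumes i: "i < length js"
  shows "delete_nth i (state J x b js) = state J x (b \<and> Suc i \<noteq> length js) (delete_nth i js)"
proof (rule nth_equalityI)
  fix k assume k: "k < length (delete_nth i (state J x b js))"
  then show "delete_nth i (state J x b js) ! k = state J x (b \<and> Suc i \<noteq> length js) (delete_nth i js) ! k"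
    using i by (auto simp: nth_delete_nth state_nth)
qed (use i in simp)

lemma sum_coset_idx:
  assumes "2 \<le> n"
  shows "(\<Sum>k\<in>coset_idx n. F k) = (\<Sum>i<n. F (int i + 1) + F (- (int i + 1)))"
proof -
  have "coset_idx n = (\<lambda>i. int i + 1) ` {..<n} \<union> (\<lambda>i. - (int i + 1)) ` {..<n}"
  proof
    show "coset_idx n \<subseteq> (\<lambda>i. int i + 1) ` {..<n} \<union> (\<lambda>i. - (int i + 1)) ` {..<n}"
    proof
      fix k assume k: "k \<in> coset_idx n"
      show "k \<in> (\<lambda>i. int i + 1) ` {..<n} \<union> (\<lambda>i. - (int i + 1)) ` {..<n}"
      proof (cases "k > 0")
        case True
        then have "k = int (nat (k - 1)) + 1" "nat (k - 1) < n" using k assms by (auto simp: coset_idx_def)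
        then show ?thesis by blast
      next
        case False
        then have "k = - (int (nat (- k - 1)) + 1)" "nat (- k - 1) < n" using k assms by (auto simp: coset_idx_def)
        then show ?thesis by blast
      qed
    qed
  qed (use assms in \<open>auto simp: coset_idx_def\<close>)
  then have "sum F (coset_idx n) = sum F ((\<lambda>i. int i + 1) ` {..<n}) + sum F ((\<lambda>i. - (int i + 1)) ` {..<n})"
    by (simp only:) (rule sum.union_disjoint, auto)
  also have "\<dots> = (\<Sum>i<n. F (int i + 1)) + (\<Sum>i<n. F (- (int i + 1)))"
    by (subst (1 2) sum.reindex) (auto simp: inj_on_def)
  finally show ?thesis by (simp add: sum.distrib)
qed

text \<open>
  The sign \<open>p\<close> is that of the inner product that is actually formed. If the last vector is
  contracted, it may already carry the involution, and then the positive representative yields a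
  negative pair and vice versa. The two representatives have the same length in this case, so the
  sum over both may be reordered by \<open>p\<close>; in terms of \<open>p\<close> the new bit is \<open>b \<noteq> p\<close> in all cases. With
  only one vector left there is no negative representative, so the involution it carries decides
  the sign, and \<open>b \<noteq> p\<close> is false, as it has to be for the empty tuple.
\<close>

lemma annih_state:
  assumes J: "selfadjoint_involution J" and js: "js \<noteq> []"
  shows "annih J q y (etens (state J x b js)) = (\<lambda>zs. \<Sum>i<length js. \<Sum>p\<in>(if length js = 1 then {b} else UNIV).
     complex_of_real (q ^ (i + (if p then 2 * (length js - 1 - i) else 0))) *
     cinner y ((if p then J else id) (x (js ! i))) *
     etens (state J x (b \<noteq> p) (delete_nth i js)) zs)"
proof -
  define n where "n = length js"
  let ?ys = "state J x b js"
  have JJ: "\<And>y. J (J y) = y" using J by (simp add: selfadjoint_involution_def)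
  obtain m where m: "n = Suc m" using js by (cases js) (auto simp: n_def)
  have ys: "length ?ys = n" by (simp add: n_def)
  have pos: "sact J (coset_rep n (int i + 1)) ?ys = ?ys ! i # delete_nth i ?ys" if "i < n" for i
    using sact_coset_rep_pos[of i ?ys J] that by (simp add: n_def)
  note A = annih_etens_coset[OF J ys[unfolded m], of q y, folded m]
  show ?thesis
  proof (cases "n = 1")
    case True
    then have "js = [js ! 0]" by (cases js) (auto simp: n_def)
    then obtain j where j: "js = [j]" by metis
    have "coset_idx n = {1}" using True by (simp add: coset_idx_def)
    moreover have "sact J (coset_rep n 1) ?ys = ?ys ! 0 # delete_nth 0 ?ys" using pos[of 0] True by simp
    ultimately show ?thesis unfolding A
      by (auto simp: coset_len_def j state_nth delete_nth_def state_Cons)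
  next
    case False
    then have n2: "2 \<le> n" using m by simp
    have neg: "sact J (coset_rep n (- (int i + 1))) ?ys = J (?ys ! i) # apply_last J (delete_nth i ?ys)" if "i < n" for i
      using sact_coset_rep_neg[OF J, of ?ys i] that n2 by (simp add: n_def del: minus_add_distrib)
    have "(\<Sum>k\<in>coset_idx n. complex_of_real (q ^ coset_len n k) *
        cinner y (hd (sact J (coset_rep n k) ?ys)) * etens (tl (sact J (coset_rep n k) ?ys)) zs) =
      (\<Sum>i<n. \<Sum>p\<in>UNIV. complex_of_real (q ^ (i + (if p then 2 * (n - 1 - i) else 0))) *
        cinner y ((if p then J else id) (x (js ! i))) * etens (state J x (b \<noteq> p) (delete_nth i js)) zs)" for zs
      unfolding sum_coset_idx[OF n2]
    proof (rule sum.cong[OF refl])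
      fix i assume "i \<in> {..<n}"
      then have i: "i < n" "i < length js" by (auto simp: n_def)
      have l: "coset_len n (int i + 1) = i" "coset_len n (- (int i + 1)) = i + 2 * (n - 1 - i)"
        using i by (auto simp: coset_len_def)
      let ?t = "\<lambda>p. complex_of_real (q ^ (i + (if p then 2 * (n - 1 - i) else 0))) *
        cinner y ((if p then J else id) (x (js ! i))) * etens (state J x (b \<noteq> p) (delete_nth i js)) zs"
      have "complex_of_real (q ^ coset_len n (int i + 1)) *
          cinner y (hd (sact J (coset_rep n (int i + 1)) ?ys)) * etens (tl (sact J (coset_rep n (int i + 1)) ?ys)) zs +
        complex_of_real (q ^ coset_len n (- (int i + 1))) *
          cinner y (hd (sact J (coset_rep n (- (int i + 1))) ?ys)) * etens (tl (sact J (coset_rep n (- (int i + 1))) ?ys)) zs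
        = ?t False + ?t True"
      proof (cases "Suc i = length js")
        case True
        then have "n - 1 - i = 0" by (simp add: n_def)
        then show ?thesis unfolding pos[OF i(1)] neg[OF i(1)] l
          using True by (cases b) (simp_all add: state_nth[OF i(2)] delete_state[OF i(2)] apply_last_state JJ)
      next
        case False
        then show ?thesis unfolding pos[OF i(1)] neg[OF i(1)] l
          by (simp add: state_nth[OF i(2)] delete_state[OF i(2)] apply_last_state JJ)
      qed
      then show "complex_of_real (q ^ coset_len n (int i + 1)) *
          cinner y (hd (sact J (coset_rep n (int i + 1)) ?ys)) * etens (tl (sact J (coset_rep n (int i + 1)) ?ys)) zs +
        complex_of_real (q ^ coset_len n (- (int i + 1))) *
          cinner y (hd (sact J (coset_rep n (- (int i + 1))) ?ys)) * etens (tl (sact J (coset_rep n (- (int i + 1))) ?ys)) zs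
        = (\<Sum>p\<in>UNIV. ?t p)"
        by (simp only: UNIV_bool) (simp del: of_real_power)
    qed
    then show ?thesis using False unfolding A n_def[symmetric] by simp
  qed
qed

text \<open>
  The vacuum component after the operators at the positions \<open>i, \<dots>, 1\<close> have been applied to \<open>f\<close>.
\<close>

definition vev where
  "vev J q \<alpha> \<beta> x i f = foldr (\<lambda>k. field_op J q (\<alpha> k) (\<beta> k) (x k)) [1..<Suc i] f []"

lemma vev_0: "vev J q \<alpha> \<beta> x 0 f = f []"
  by (simp add: vev_def)

lemma vev_Suc: "vev J q \<alpha> \<beta> x (Suc i) f = vev J q \<alpha> \<beta> x i (field_op J q (\<alpha> (Suc i)) (\<beta> (Suc i)) (x (Suc i)) f)"
  by (simp add: vev_def upt_Suc_append[of 1 "Suc i"])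

lemma field_op_lin: "field_op J q a b y (\<lambda>zs. c * f zs + d * g zs) =
   (\<lambda>zs. c * field_op J q a b y f zs + d * field_op J q a b y g zs)"
  unfolding field_op_def annih_lin create_lin by (simp add: algebra_simps)

lemma vev_lin: "vev J q \<alpha> \<beta> x i (\<lambda>zs. c * f zs + d * g zs) = c * vev J q \<alpha> \<beta> x i f + d * vev J q \<alpha> \<beta> x i g"
  by (induction i arbitrary: f g) (simp_all add: vev_0 vev_Suc field_op_lin)

lemma vev_sum: "finite A \<Longrightarrow> vev J q \<alpha> \<beta> x i (\<lambda>zs. \<Sum>a\<in>A. c a * F a zs) = (\<Sum>a\<in>A. c a * vev J q \<alpha> \<beta> x i (F a))"
proof (induction A rule: finite_induct)
  case empty
  show ?case using vev_lin[of J q \<alpha> \<beta> x i 0 "\<lambda>_. 0" 0 "\<lambda>_. 0"] by simp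
next
  case (insert a A)
  then show ?case using vev_lin[of J q \<alpha> \<beta> x i "c a" "F a" 1 "\<lambda>zs. \<Sum>a\<in>A. c a * F a zs"] by simp
qed

lemma sorted_nth_card:
  fixes js :: "nat list"
  assumes "sorted_wrt (<) js" "i < length js"
  shows "card {l \<in> set js. l < js ! i} = i" "card {l \<in> set js. js ! i < l} = length js - 1 - i"
proof -
  have lt: "js ! k < js ! l \<longleftrightarrow> k < l" if "k < length js" "l < length js" for k l
    using sorted_wrt_nth_less[OF assms(1)] that by (metis linorder_neqE_nat order_less_asym less_irrefl)
  have d: "distinct js" using assms(1) strict_sorted_iff by blast
  have inj: "inj_on ((!) js) A" if "A \<subseteq> {..<length js}" for A
    using d that by (auto simp: inj_on_def nth_eq_iff_index_eq subset_iff)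
  have im: "{l \<in> set js. P l} = (!) js ` {k \<in> {..<length js}. P (js ! k)}" for P
    by (auto simp: in_set_conv_nth)
  have "{k \<in> {..<length js}. js ! k < js ! i} = {..<i}" using lt[OF _ assms(2)] assms(2) by auto
  then show "card {l \<in> set js. l < js ! i} = i"
    unfolding im using inj[of "{..<i}"] assms(2) by (simp add: card_image subset_iff)
  have "{k \<in> {..<length js}. js ! i < js ! k} = {Suc i..<length js}" using lt[OF assms(2)] by auto
  then show "card {l \<in> set js. js ! i < l} = length js - 1 - i"
    unfolding im using inj[of "{Suc i..<length js}"] assms(2) by (simp add: card_image subset_iff)
qed

lemma delete_nth_sorted:
  fixes js :: "nat list"
  assumes "sorted_wrt (<) js" "i < length js"
  shows "set (delete_nth i js) = set js - {js ! i}" "sorted_wrt (<) (delete_nth i js)"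
proof -
  have e: "js = take i js @ js ! i # drop (Suc i) js" using assms(2) by (rule id_take_nth_drop)
  have "sorted_wrt (<) (take i js @ js ! i # drop (Suc i) js)" using assms(1) e by simp
  then show "sorted_wrt (<) (delete_nth i js)" unfolding delete_nth_def by (auto simp: sorted_wrt_append)
  have "distinct (take i js @ js ! i # drop (Suc i) js)" using assms(1) e strict_sorted_iff by metis
  moreover have "set js = set (take i js @ js ! i # drop (Suc i) js)" using e by simp
  ultimately show "set (delete_nth i js) = set js - {js ! i}" unfolding delete_nth_def by auto
qed

text \<open>
  The coefficients \<open>\<beta> j\<close> of the waiting positions were collected when these vectors were created,
  while on the right they belong to pairs that are yet to be formed; the product on the left
  accounts for this. On the empty tuple there is nothing to carry the involution, so the bit
  must be false.
\<close>

lemma vev_state: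
  assumes J: "selfadjoint_involution J"
  shows "sorted_wrt (<) js \<Longrightarrow> (\<And>j. j \<in> set js \<Longrightarrow> i < j) \<Longrightarrow> js = [] \<longrightarrow> \<not> b \<Longrightarrow>
    (\<Prod>j\<in>set js. \<beta> j) * vev J q \<alpha> \<beta> x i (etens (state J x b js)) =
    (\<Sum>(\<pi>, f)\<in>completions i (set js) b. amplitude J q x \<alpha> \<beta> \<pi> f)"
proof (induction i arbitrary: js b)
  case 0
  then have js: "0 \<notin> set js" by blast
  show ?case
  proof (cases js)
    case Nil
    then show ?thesis
      by (simp add: completions_0 vev_0 etens_Nil amplitude_def pair_weight_def cr_def cnp_def)
  next
    case (Cons j js')
    then have "etens (state J x b js) [] = 0" by (intro etens_length) simp
    moreover have "completions 0 (set js) b = {}" using Cons completions_0[OF js] by simp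
    ultimately show ?thesis by (simp only: vev_0 mult_zero_right sum.empty)
  qed
next
  case (Suc i)
  let ?S = "set js" and ?y = "x (Suc i)" and ?V = "vev J q \<alpha> \<beta> x i"
  have S: "finite ?S" "\<And>l. l \<in> ?S \<Longrightarrow> Suc i < l" using Suc.prems by auto
  have d: "distinct js" using Suc.prems(1) strict_sorted_iff by blast
  have lS: "length js = card ?S" using d by (simp add: distinct_card)
  have v: "vev J q \<alpha> \<beta> x (Suc i) (etens (state J x b js)) =
      \<alpha> (Suc i) * ?V (annih J q ?y (etens (state J x b js))) + \<beta> (Suc i) * ?V (create ?y (etens (state J x b js)))"
    unfolding vev_Suc field_op_def vev_lin ..
  have "create ?y (etens (state J x b js)) = etens (state J x b (Suc i # js))"
    using Suc.prems(3) by (subst state_Cons) (auto simp: create_etens)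
  moreover have "(\<Prod>j\<in>set (Suc i # js). \<beta> j) * ?V (etens (state J x b (Suc i # js))) =
      (\<Sum>(\<pi>, f)\<in>completions i (set (Suc i # js)) b. amplitude J q x \<alpha> \<beta> \<pi> f)"
  proof (rule Suc.IH)
    show "sorted_wrt (<) (Suc i # js)" using Suc.prems(1) S(2) by simp
    show "i < j" if "j \<in> set (Suc i # js)" for j using that S(2)[of j] by auto
  qed simp
  moreover have "(\<Prod>j\<in>set (Suc i # js). \<beta> j) = \<beta> (Suc i) * (\<Prod>j\<in>?S. \<beta> j)"
  proof -
    have "Suc i \<notin> ?S" using S(2)[of "Suc i"] by blast
    then show ?thesis by simp
  qed
  ultimately have "\<beta> (Suc i) * (\<Prod>j\<in>?S. \<beta> j) * ?V (create ?y (etens (state J x b js))) =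
      (\<Sum>(\<pi>, f)\<in>completions i (insert (Suc i) ?S) b. amplitude J q x \<alpha> \<beta> \<pi> f)"
    by (simp only: list.set)
  then have cre: "(\<Prod>j\<in>?S. \<beta> j) * (\<beta> (Suc i) * ?V (create ?y (etens (state J x b js)))) =
      (\<Sum>(\<pi>, f)\<in>completions i (insert (Suc i) ?S) b. amplitude J q x \<alpha> \<beta> \<pi> f)"
    by (simp only: mult_ac)
  let ?c = "\<lambda>j p. complex_of_real (q ^ (card {l \<in> ?S. l < j} + (if p then 2 * card {l \<in> ?S. j < l} else 0))) *
       cinner ?y ((if p then J else id) (x j))"
  let ?W = "\<lambda>j p. \<Sum>(\<pi>, f)\<in>completions i (?S - {j}) (b \<noteq> p). amplitude J q x \<alpha> \<beta> \<pi> f"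
  have ann: "(\<Prod>j\<in>?S. \<beta> j) * ?V (annih J q ?y (etens (state J x b js))) =
      (\<Sum>j\<in>?S. \<Sum>p\<in>colours ?S b. \<beta> j * ?c j p * ?W j p)"
  proof (cases "js = []")
    case True
    have "?V (\<lambda>_. 0) = 0" using vev_sum[of "{}" J q \<alpha> \<beta> x i] by simp
    then show ?thesis using True by (simp add: annih_etens_Nil)
  next
    case False
    let ?F = "\<lambda>k p. etens (state J x (b \<noteq> p) (delete_nth k js))"
    have "annih J q ?y (etens (state J x b js)) = (\<lambda>zs. \<Sum>(k, p)\<in>{..<length js} \<times> colours ?S b. ?c (js ! k) p * ?F k p zs)"
      unfolding annih_state[OF J False] sum.cartesian_product[symmetric] colours_def lS[symmetric]
      by (intro ext sum.cong refl) (simp add: sorted_nth_card[OF Suc.prems(1)])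
    then have "?V (annih J q ?y (etens (state J x b js))) =
        (\<Sum>(k, p)\<in>{..<length js} \<times> colours ?S b. ?c (js ! k) p * ?V (?F k p))"
      using vev_sum[of "{..<length js} \<times> colours ?S b" J q \<alpha> \<beta> x i "\<lambda>(k, p). ?c (js ! k) p" "\<lambda>(k, p). ?F k p"]
      by (simp add: case_prod_unfold colours_def)
    then have "(\<Prod>j\<in>?S. \<beta> j) * ?V (annih J q ?y (etens (state J x b js))) =
        (\<Sum>k<length js. \<Sum>p\<in>colours ?S b. (\<Prod>j\<in>?S. \<beta> j) * (?c (js ! k) p * ?V (?F k p)))"
      by (simp only: sum.cartesian_product[symmetric] sum_distrib_left)
    also have "\<dots> = (\<Sum>k<length js. \<Sum>p\<in>colours ?S b. \<beta> (js ! k) * ?c (js ! k) p * ?W (js ! k) p)"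
    proof (intro sum.cong refl)
      fix k p assume k: "k \<in> {..<length js}" and p: "p \<in> colours ?S b"
      then have k': "k < length js" by simp
      note D = delete_nth_sorted[OF Suc.prems(1) k']
      have "delete_nth k js = [] \<longrightarrow> \<not> (b \<noteq> p)"
      proof
        assume "delete_nth k js = []"
        then have "length js = 1" using k' length_delete_nth[OF k'] by simp
        then show "\<not> (b \<noteq> p)" using p lS by (simp add: colours_def)
      qed
      then have IH: "(\<Prod>j\<in>?S - {js ! k}. \<beta> j) * ?V (?F k p) = ?W (js ! k) p"
        using Suc.IH[OF D(2), of "b \<noteq> p"] S(2) unfolding D(1) by (simp add: Suc_lessD)
      have "(\<Prod>j\<in>?S. \<beta> j) = \<beta> (js ! k) * (\<Prod>j\<in>?S - {js ! k}. \<beta> j)"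
        using k' by (intro prod.remove) auto
      then show "(\<Prod>j\<in>?S. \<beta> j) * (?c (js ! k) p * ?V (?F k p)) = \<beta> (js ! k) * ?c (js ! k) p * ?W (js ! k) p"
        unfolding IH[symmetric] by (simp add: mult_ac)
    qed
    also have "\<dots> = (\<Sum>j\<in>?S. \<Sum>p\<in>colours ?S b. \<beta> j * ?c j p * ?W j p)"
      using d by (intro sum.reindex_bij_betw bij_betw_nth) auto
    finally show ?thesis .
  qed
  have "(\<Prod>j\<in>?S. \<beta> j) * vev J q \<alpha> \<beta> x (Suc i) (etens (state J x b js)) =
      (\<Sum>(\<pi>, f)\<in>completions i (insert (Suc i) ?S) b. amplitude J q x \<alpha> \<beta> \<pi> f) +
      \<alpha> (Suc i) * ((\<Prod>j\<in>?S. \<beta> j) * ?V (annih J q ?y (etens (state J x b js))))"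
    unfolding v distrib_left cre by (simp only: mult_ac add.commute)
  also have "\<dots> = (\<Sum>(\<pi>, f)\<in>completions (Suc i) ?S b. amplitude J q x \<alpha> \<beta> \<pi> f)"
  proof -
    have "a * (\<Sum>j\<in>?S. \<Sum>p\<in>colours ?S b. F j p) = (\<Sum>j\<in>?S. \<Sum>p\<in>colours ?S b. a * F j p)" for a :: complex and F
      by (simp only: sum_distrib_left)
    moreover have "\<forall>l\<in>?S. Suc i < l" using S(2) by blast
    ultimately show ?thesis unfolding ann sum_completions_Suc[OF S(1) \<open>\<forall>l\<in>?S. Suc i < l\<close>] by (simp only: mult.assoc)
  qed
  finally show ?case .
qed

lemma completions_empty: "completions n {} False = pair_partitions_D n"
proof -
  have "Min V \<le> n" if "partition_on {1..n} \<pi>" "V \<in> \<pi>" "card V = 2" for \<pi> V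
    using card_2_Min_Max(1)[OF that(3)] partition_onD1[OF that(1)] that(2) by (metis UnionI atLeastAtMost_iff insertI1)
  then show ?thesis unfolding completions_def pair_partitions_D_def pair_partitions_def by auto
qed

text \<open>
  Initially no position waits and no pair has been formed, so all pair partitions of type D are
  completions.
\<close>

lemma vacuum_expectation_sum:
  assumes J: "selfadjoint_involution J"
    and T: "\<And>i f. T i f = (\<lambda>zs. \<alpha> i * annihilation J q (x i) f zs + \<beta> i * creation (x i) f zs)"
  shows "fock_inner J q vacuum (foldr T [1..<Suc n] vacuum) =
    (\<Sum>(\<pi>, f)\<in>pair_partitions_D n. (\<Prod>V\<in>\<pi>. \<alpha> (Min V) * \<beta> (Max V)) * pair_weight J q x \<pi> f)"
proof -
  have "fock_inner J q vacuum (foldr T [1..<Suc n] vacuum) = vev J q \<alpha> \<beta> x n (etens (state J x False []))"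
    unfolding vev_def state_Nil vacuum_def[symmetric] by (rule vacuum_expectation[OF J T])
  also have "\<dots> = (\<Sum>(\<pi>, f)\<in>completions n (set []) False. amplitude J q x \<alpha> \<beta> \<pi> f)"
    using vev_state[OF J, of "[]" n False \<beta> q \<alpha> x] by simp
  finally show ?thesis by (simp only: list.set completions_empty amplitude_def)
qed

theorem theorem4p15:
  fixes J :: "'h::complex_hilbert \<Rightarrow> 'h" and q :: real and n :: nat
    and x :: "nat \<Rightarrow> 'h" and \<epsilon> :: "nat \<Rightarrow> ladder"
  assumes "selfadjoint_involution J"
    and "- 1 < q" and "q < 1"
    and "n \<ge> 1"
  shows "fock_inner J q vacuum
           (foldr (\<lambda>i. ladder_op J q (\<epsilon> i) (x i)) [1..<Suc n] vacuum) =
         (\<Sum>(\<pi>, f)\<in>pair_partitions_D_eps n \<epsilon>. pair_weight J q x \<pi> f) \<and>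
         fock_inner J q vacuum
           (foldr (\<lambda>i. gaussian J q (x i)) [1..<Suc n] vacuum) =
         (\<Sum>(\<pi>, f)\<in>pair_partitions_D n. pair_weight J q x \<pi> f)"
proof
  \<comment> \<open>With these coefficients exactly the pair partitions compatible with \<open>\<epsilon>\<close> contribute.\<close>
  let ?a = "\<lambda>i. of_bool (\<epsilon> i = Ann) :: complex" and ?c = "\<lambda>i. of_bool (\<epsilon> i = Cre) :: complex"
  have "ladder_op J q (\<epsilon> i) (x i) f =
      (\<lambda>zs. ?a i * annihilation J q (x i) f zs + ?c i * creation (x i) f zs)" for i f
    by (cases "\<epsilon> i") (simp_all add: ladder_op_def)
  from vacuum_expectation_sum[OF assms(1) this]
  have "fock_inner J q vacuum (foldr (\<lambda>i. ladder_op J q (\<epsilon> i) (x i)) [1..<Suc n] vacuum) =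
      (\<Sum>(\<pi>, f)\<in>pair_partitions_D n. (\<Prod>V\<in>\<pi>. ?a (Min V) * ?c (Max V)) * pair_weight J q x \<pi> f)" .
  also have "\<dots> = (\<Sum>(\<pi>, f)\<in>pair_partitions_D_eps n \<epsilon>. pair_weight J q x \<pi> f)"
  proof (rule sum.mono_neutral_cong_right)
    show fin: "finite (pair_partitions_D n)" using finite_completions[of "{}" n False] by (simp add: completions_empty)
    show "pair_partitions_D_eps n \<epsilon> \<subseteq> pair_partitions_D n" by (auto simp: pair_partitions_D_eps_def)
    show "\<forall>a\<in>pair_partitions_D n - pair_partitions_D_eps n \<epsilon>.
        (case a of (\<pi>, f) \<Rightarrow> (\<Prod>V\<in>\<pi>. ?a (Min V) * ?c (Max V)) * pair_weight J q x \<pi> f) = 0"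
    proof
      fix a assume a: "a \<in> pair_partitions_D n - pair_partitions_D_eps n \<epsilon>"
      obtain \<pi> f where a': "a = (\<pi>, f)" by fastforce
      have "partition_on {1..n} \<pi>" using a by (simp add: a' pair_partitions_D_def pair_partitions_def)
      then have "finite \<pi>" by (rule finite_elements[rotated]) simp
      moreover obtain V where "V \<in> \<pi>" "\<epsilon> (Min V) \<noteq> Ann \<or> \<epsilon> (Max V) \<noteq> Cre"
        using a unfolding a' pair_partitions_D_eps_def by blast
      ultimately have "(\<Prod>V\<in>\<pi>. ?a (Min V) * ?c (Max V)) = 0" by (intro prod_zero bexI[of _ V]) auto
      then show "(case a of (\<pi>, f) \<Rightarrow> (\<Prod>V\<in>\<pi>. ?a (Min V) * ?c (Max V)) * pair_weight J q x \<pi> f) = 0"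
        by (simp only: a' prod.case mult_zero_left)
    qed
    show "(case a of (\<pi>, f) \<Rightarrow> (\<Prod>V\<in>\<pi>. ?a (Min V) * ?c (Max V)) * pair_weight J q x \<pi> f) =
        (case a of (\<pi>, f) \<Rightarrow> pair_weight J q x \<pi> f)" if "a \<in> pair_partitions_D_eps n \<epsilon>" for a
      using that by (auto simp: pair_partitions_D_eps_def)
  qed
  finally show "fock_inner J q vacuum (foldr (\<lambda>i. ladder_op J q (\<epsilon> i) (x i)) [1..<Suc n] vacuum) =
      (\<Sum>(\<pi>, f)\<in>pair_partitions_D_eps n \<epsilon>. pair_weight J q x \<pi> f)" .
  have "gaussian J q (x i) f = (\<lambda>zs. 1 * annihilation J q (x i) f zs + 1 * creation (x i) f zs)" for i f
    by (simp add: gaussian_def)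
  from vacuum_expectation_sum[OF assms(1) this]
  show "fock_inner J q vacuum (foldr (\<lambda>i. gaussian J q (x i)) [1..<Suc n] vacuum) =
      (\<Sum>(\<pi>, f)\<in>pair_partitions_D n. pair_weight J q x \<pi> f)" by simp
qed

end
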